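(* There is no almost linear minimal field.
   Context: An infinite first-order structure $M$ is minimal if every subset of $M$ definable in $M$ with parameters is finite or co-finite. A minimal field is a minimal structure which is a field, possibly with additional first-order structure. The generic type of a minimal structure $M$ is the unique non-algebraic type $p\in S_1(M)$; let $\bar M\succ M$ be a monster model and $p(\bar M)$ the set of realizations of $p$ in $\bar M$. For a strict partial order $<$, incomparability is the relation $x\sim y$ iff $\neg(x<y\vee y<x)$. A strict partial order $<$ on $M$, definable with parameters and having infinite chains, is almost linear if $\sim$ is an equivalence relation on $p(\bar M)$. The structure $M$ is almost linear if such an order exists. *)

theory Defs
  imports "HOL-Algebra.Ring"
begin

unbundle cardinal_syntax

section \<open>First-order languages and structures\<close>

text \<open>
  A symbol is a name together with its arity; \<open>(f, n) \<in> Funs L\<close> says that \<open>L\<close> contains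
  the \<open>n\<close>-ary function symbol \<open>f\<close>. There is no restriction on the cardinality of a language.
\<close>

record ('f, 'r) language =
  Funs :: "('f \<times> nat) set"
  Rels :: "('r \<times> nat) set"

datatype 'f tm = Var nat | App 'f "'f tm list"

datatype ('f, 'r) fm =
    Eq "'f tm" "'f tm"
  | Rel 'r "'f tm list"
  | Neg "('f, 'r) fm"
  | Conj "('f, 'r) fm" "('f, 'r) fm"
  | Ex nat "('f, 'r) fm"

primrec wf_tm :: "('f, 'r) language \<Rightarrow> 'f tm \<Rightarrow> bool" where
  "wf_tm L (Var x) \<longleftrightarrow> True"
| "wf_tm L (App f ts) \<longleftrightarrow> (f, length ts) \<in> Funs L \<and> list_all (wf_tm L) ts"

primrec wf_fm :: "('f, 'r) language \<Rightarrow> ('f, 'r) fm \<Rightarrow> bool" where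
  "wf_fm L (Eq t u) \<longleftrightarrow> wf_tm L t \<and> wf_tm L u"
| "wf_fm L (Rel r ts) \<longleftrightarrow> (r, length ts) \<in> Rels L \<and> list_all (wf_tm L) ts"
| "wf_fm L (Neg \<phi>) \<longleftrightarrow> wf_fm L \<phi>"
| "wf_fm L (Conj \<phi> \<psi>) \<longleftrightarrow> wf_fm L \<phi> \<and> wf_fm L \<psi>"
| "wf_fm L (Ex x \<phi>) \<longleftrightarrow> wf_fm L \<phi>"

definition formulas :: "('f, 'r) language \<Rightarrow> ('f, 'r) fm set" where
  "formulas L = {\<phi>. wf_fm L \<phi>}"

fun fv_tm :: "'f tm \<Rightarrow> nat set" where
  "fv_tm (Var x) = {x}"
| "fv_tm (App f ts) = (\<Union>t\<in>set ts. fv_tm t)"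

primrec fv :: "('f, 'r) fm \<Rightarrow> nat set" where
  "fv (Eq t u) = fv_tm t \<union> fv_tm u"
| "fv (Rel r ts) = (\<Union>t\<in>set ts. fv_tm t)"
| "fv (Neg \<phi>) = fv \<phi>"
| "fv (Conj \<phi> \<psi>) = fv \<phi> \<union> fv \<psi>"
| "fv (Ex x \<phi>) = fv \<phi> - {x}"

record ('f, 'r, 'a) struct =
  univ :: "'a set"
  fun_int :: "'f \<Rightarrow> 'a list \<Rightarrow> 'a"
  rel_int :: "'r \<Rightarrow> 'a list \<Rightarrow> bool"

definition is_struct :: "('f, 'r) language \<Rightarrow> ('f, 'r, 'a) struct \<Rightarrow> bool" where
  "is_struct L M \<longleftrightarrow> univ M \<noteq> {} \<and>
     (\<forall>(f, n) \<in> Funs L. \<forall>xs. length xs = n \<and> set xs \<subseteq> univ M \<longrightarrow> fun_int M f xs \<in> univ M)"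

primrec eval :: "('f, 'r, 'a) struct \<Rightarrow> (nat \<Rightarrow> 'a) \<Rightarrow> 'f tm \<Rightarrow> 'a" where
  "eval M s (Var x) = s x"
| "eval M s (App f ts) = fun_int M f (map (eval M s) ts)"

primrec sat :: "('f, 'r, 'a) struct \<Rightarrow> (nat \<Rightarrow> 'a) \<Rightarrow> ('f, 'r) fm \<Rightarrow> bool" where
  "sat M s (Eq t u) \<longleftrightarrow> eval M s t = eval M s u"
| "sat M s (Rel r ts) \<longleftrightarrow> rel_int M r (map (eval M s) ts)"
| "sat M s (Neg \<phi>) \<longleftrightarrow> \<not> sat M s \<phi>"
| "sat M s (Conj \<phi> \<psi>) \<longleftrightarrow> sat M s \<phi> \<and> sat M s \<psi>"
| "sat M s (Ex x \<phi>) \<longleftrightarrow> (\<exists>a\<in>univ M. sat M (s(x := a)) \<phi>)"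


section \<open>Definable sets and types\<close>

text \<open>
  A formula with parameters from \<open>A\<close> in the object variables \<open>0, \<dots>, n - 1\<close> is a pair
  \<open>(\<phi>, s)\<close>: the variables of \<open>\<phi>\<close> with index at least \<open>n\<close> stand for the parameters,
  and \<open>s\<close> assigns them values in \<open>A\<close>. The values of \<open>s\<close> elsewhere are irrelevant.
\<close>

definition pformulas :: "('f, 'r) language \<Rightarrow> nat \<Rightarrow> 'a set \<Rightarrow> (('f, 'r) fm \<times> (nat \<Rightarrow> 'a)) set" where
  "pformulas L n A = {(\<phi>, s). \<phi> \<in> formulas L \<and> (\<forall>x \<in> fv \<phi>. n \<le> x \<longrightarrow> s x \<in> A)}"

fun sat1 :: "('f, 'r, 'a) struct \<Rightarrow> ('f, 'r) fm \<times> (nat \<Rightarrow> 'a) \<Rightarrow> 'a \<Rightarrow> bool" where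
  "sat1 M (\<phi>, s) a \<longleftrightarrow> sat M (s(0 := a)) \<phi>"

fun sat2 :: "('f, 'r, 'a) struct \<Rightarrow> ('f, 'r) fm \<times> (nat \<Rightarrow> 'a) \<Rightarrow> 'a \<Rightarrow> 'a \<Rightarrow> bool" where
  "sat2 M (\<phi>, s) a b \<longleftrightarrow> sat M (s(0 := a, 1 := b)) \<phi>"

definition definable :: "('f, 'r) language \<Rightarrow> ('f, 'r, 'a) struct \<Rightarrow> 'a set \<Rightarrow> bool" where
  "definable L M X \<longleftrightarrow> (\<exists>\<theta> \<in> pformulas L 1 (univ M). X = {a \<in> univ M. sat1 M \<theta> a})"

text \<open>Complete 1-types over \<open>A\<close> in the sense of \<open>M\<close>, that is, the set $S_1(A)$.\<close>

definition types1 ::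
  "('f, 'r) language \<Rightarrow> ('f, 'r, 'a) struct \<Rightarrow> 'a set \<Rightarrow> (('f, 'r) fm \<times> (nat \<Rightarrow> 'a)) set set" where
  "types1 L M A = {p. p \<subseteq> pformulas L 1 A \<and>
     (\<forall>F \<subseteq> p. finite F \<longrightarrow> (\<exists>a \<in> univ M. \<forall>\<theta> \<in> F. sat1 M \<theta> a)) \<and>
     (\<forall>(\<phi>, s) \<in> pformulas L 1 A. (\<phi>, s) \<in> p \<or> (Neg \<phi>, s) \<in> p)}"

definition algebraic_type ::
  "('f, 'r, 'a) struct \<Rightarrow> (('f, 'r) fm \<times> (nat \<Rightarrow> 'a)) set \<Rightarrow> bool" where
  "algebraic_type M p \<longleftrightarrow> (\<exists>\<theta> \<in> p. finite {a \<in> univ M. sat1 M \<theta> a})"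

definition realizations ::
  "('f, 'r, 'a) struct \<Rightarrow> (('f, 'r) fm \<times> (nat \<Rightarrow> 'a)) set \<Rightarrow> 'a set" where
  "realizations N p = {a \<in> univ N. \<forall>\<theta> \<in> p. sat1 N \<theta> a}"


section \<open>Monster models\<close>

definition elementary_extension ::
  "('f, 'r) language \<Rightarrow> ('f, 'r, 'a) struct \<Rightarrow> ('f, 'r, 'a) struct \<Rightarrow> bool" where
  "elementary_extension L M N \<longleftrightarrow> univ M \<subseteq> univ N \<and>
     (\<forall>\<phi> \<in> formulas L. \<forall>s. (\<forall>x \<in> fv \<phi>. s x \<in> univ M) \<longrightarrow> (sat M s \<phi> \<longleftrightarrow> sat N s \<phi>))"

definition saturated :: "('f, 'r) language \<Rightarrow> 'k rel \<Rightarrow> ('f, 'r, 'a) struct \<Rightarrow> bool" where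
  "saturated L \<kappa> N \<longleftrightarrow>
     (\<forall>A \<subseteq> univ N. |A| <o \<kappa> \<longrightarrow> (\<forall>p \<in> types1 L N A. realizations N p \<noteq> {}))"

definition elementary_map ::
  "('f, 'r) language \<Rightarrow> ('f, 'r, 'a) struct \<Rightarrow> 'a set \<Rightarrow> ('a \<Rightarrow> 'a) \<Rightarrow> bool" where
  "elementary_map L N A h \<longleftrightarrow> A \<subseteq> univ N \<and> h ` A \<subseteq> univ N \<and>
     (\<forall>\<phi> \<in> formulas L. \<forall>s. (\<forall>x \<in> fv \<phi>. s x \<in> A) \<longrightarrow> (sat N s \<phi> \<longleftrightarrow> sat N (h \<circ> s) \<phi>))"

definition automorphism ::
  "('f, 'r) language \<Rightarrow> ('f, 'r, 'a) struct \<Rightarrow> ('a \<Rightarrow> 'a) \<Rightarrow> bool" where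
  "automorphism L N \<sigma> \<longleftrightarrow> bij_betw \<sigma> (univ N) (univ N) \<and>
     (\<forall>(f, n) \<in> Funs L. \<forall>xs. length xs = n \<and> set xs \<subseteq> univ N \<longrightarrow>
        \<sigma> (fun_int N f xs) = fun_int N f (map \<sigma> xs)) \<and>
     (\<forall>(r, n) \<in> Rels L. \<forall>xs. length xs = n \<and> set xs \<subseteq> univ N \<longrightarrow>
        (rel_int N r xs \<longleftrightarrow> rel_int N r (map \<sigma> xs)))"

definition strongly_homogeneous ::
  "('f, 'r) language \<Rightarrow> 'k rel \<Rightarrow> ('f, 'r, 'a) struct \<Rightarrow> bool" where
  "strongly_homogeneous L \<kappa> N \<longleftrightarrow>
     (\<forall>A h. |A| <o \<kappa> \<and> elementary_map L N A h \<longrightarrow>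
        (\<exists>\<sigma>. automorphism L N \<sigma> \<and> (\<forall>a \<in> A. \<sigma> a = h a)))"

text \<open>
  \<open>N\<close> is a monster model extending \<open>M\<close>, with \<open>\<kappa>\<close> as the bound for small sets.
  As usual, \<open>M\<close> is small and \<open>\<kappa>\<close> exceeds the cardinality of the language, which is by
  definition that of its set of formulas. \<open>M\<close> and \<open>N\<close> share the type \<open>'a\<close>, but
  \<open>univ M\<close> may be a proper subset of \<open>univ N\<close>: a type \<open>'a\<close> large enough for the monster
  model accommodates every pair of \<open>M\<close> and a monster model of it, up to isomorphism.
\<close>

definition monster_model ::
  "('f, 'r) language \<Rightarrow> 'k rel \<Rightarrow> ('f, 'r, 'a) struct \<Rightarrow> ('f, 'r, 'a) struct \<Rightarrow> bool" where
  "monster_model L \<kappa> M N \<longleftrightarrow> is_struct L N \<and> elementary_extension L M N \<and>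
     Card_order \<kappa> \<and> |univ M| <o \<kappa> \<and> |formulas L| <o \<kappa> \<and>
     saturated L \<kappa> N \<and> strongly_homogeneous L \<kappa> N"


section \<open>Minimal fields and almost linear structures\<close>

definition minimal :: "('f, 'r) language \<Rightarrow> ('f, 'r, 'a) struct \<Rightarrow> bool" where
  "minimal L M \<longleftrightarrow> is_struct L M \<and> infinite (univ M) \<and>
     (\<forall>X. definable L M X \<longrightarrow> finite X \<or> finite (univ M - X))"

text \<open>
  The language contains symbols for addition and multiplication, and possibly further symbols
  (among them perhaps symbols for zero, one and negation, which are definable anyway).
\<close>

definition minimal_field :: "('f, 'r) language \<Rightarrow> ('f, 'r, 'a) struct \<Rightarrow> bool" where
  "minimal_field L M \<longleftrightarrow> minimal L M \<and>
     (\<exists>(R :: 'a ring) plus times. field R \<and> carrier R = univ M \<and>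
        (plus, 2) \<in> Funs L \<and> (times, 2) \<in> Funs L \<and>
        (\<forall>x \<in> univ M. \<forall>y \<in> univ M.
           fun_int M plus [x, y] = x \<oplus>\<^bsub>R\<^esub> y \<and> fun_int M times [x, y] = x \<otimes>\<^bsub>R\<^esub> y))"

definition generic_type ::
  "('f, 'r) language \<Rightarrow> ('f, 'r, 'a) struct \<Rightarrow> (('f, 'r) fm \<times> (nat \<Rightarrow> 'a)) set" where
  "generic_type L M = (THE p. p \<in> types1 L M (univ M) \<and> \<not> algebraic_type M p)"

definition strict_partial_order_on :: "'a set \<Rightarrow> ('a \<Rightarrow> 'a \<Rightarrow> bool) \<Rightarrow> bool" where
  "strict_partial_order_on A lt \<longleftrightarrow> irreflp_on A lt \<and> transp_on A lt"

definition has_infinite_chain :: "'a set \<Rightarrow> ('a \<Rightarrow> 'a \<Rightarrow> bool) \<Rightarrow> bool" where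
  "has_infinite_chain A lt \<longleftrightarrow> (\<exists>C \<subseteq> A. infinite C \<and> totalp_on C lt)"

definition incomparable :: "('a \<Rightarrow> 'a \<Rightarrow> bool) \<Rightarrow> 'a \<Rightarrow> 'a \<Rightarrow> bool" where
  "incomparable lt x y \<longleftrightarrow> \<not> (lt x y \<or> lt y x)"

text \<open>
  \<open>\<theta>\<close> defines an almost linear order on \<open>M\<close>. The order on the monster model \<open>N\<close> is the one
  defined there by the same formula with the same parameters.
\<close>

definition almost_linear_order ::
  "('f, 'r) language \<Rightarrow> ('f, 'r, 'a) struct \<Rightarrow> ('f, 'r, 'a) struct \<Rightarrow>
   ('f, 'r) fm \<times> (nat \<Rightarrow> 'a) \<Rightarrow> bool" where
  "almost_linear_order L M N \<theta> \<longleftrightarrow>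
     \<theta> \<in> pformulas L 2 (univ M) \<and>
     strict_partial_order_on (univ M) (sat2 M \<theta>) \<and>
     has_infinite_chain (univ M) (sat2 M \<theta>) \<and>
     (let P = realizations N (generic_type L M)
      in equiv P {(x, y). x \<in> P \<and> y \<in> P \<and> incomparable (sat2 N \<theta>) x y})"

definition almost_linear ::
  "('f, 'r) language \<Rightarrow> ('f, 'r, 'a) struct \<Rightarrow> ('f, 'r, 'a) struct \<Rightarrow> bool" where
  "almost_linear L M N \<longleftrightarrow> (\<exists>\<theta>. almost_linear_order L M N \<theta>)"

end

theory Submission
  imports Defs
begin

text \<open>
  Compactness turns transitivity of incomparability on the realizations of the generic type into
  transitivity outside a finite subset of \<open>M\<close>, so that \<open>M\<close> carries a definable total preorder
  all of whose classes are finite. By minimality initial segments are finite or cofinite. The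
  two-to-one map \<open>y\<^sup>2 + y\<close> excludes that infinitely many are finite and infinitely many are not;
  after reversing the order and moving finitely many elements, all initial segments are finite.
  Then \<open>x + a\<close> and \<open>x a\<close> (for \<open>a \<noteq> 0\<close>) are equivalent to \<open>x\<close> for almost all \<open>x\<close>, hence every
  element stabilizes all large initial segments. Passing to stabilizers, first for addition and then
  for multiplication, gives a definable filtration of the field by finite subfields, which the
  map \<open>y\<^sup>2 + y\<close> again shows to be impossible.
\<close>

section \<open>Coincidence and renaming\<close>

text \<open>The obstacle is that finiteness is not first-order: the set of elements whose initial
  segment is finite is not visibly definable, so minimality does not decide its size. A counting
  argument takes its place, and this is the purpose of \<open>y\<^sup>2 + y\<close>; plain squaring
  would not do, being injective in characteristic 2. Once all initial segments are finite, a set is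
  finite exactly when it is bounded, and minimality applies to conditions such as
  \<open>x + a\<close> lying above \<open>x\<close> for almost all \<open>x\<close>. A translation
  and its inverse cannot both move almost everything up, whence the equivalence of \<open>x\<close>
  and \<open>x + a\<close>. Addition comes before multiplication because distributivity preserves
  closure under addition on passing to multiplicative stabilizers. The monster model serves only for
  compactness; everything afterwards happens in \<open>M\<close>.\<close>

lemma eval_cong: "(\<And>x. x \<in> fv_tm t \<Longrightarrow> s x = s' x) \<Longrightarrow> eval S s t = eval S s' t"
proof (induction t)
  case (App f ts)
  then have "map (eval S s) ts = map (eval S s') ts" by auto
  then show ?case by (metis eval.simps(2))
qed simp

lemma sat_cong: "(\<And>x. x \<in> fv \<phi> \<Longrightarrow> s x = s' x) \<Longrightarrow> sat S s \<phi> \<longleftrightarrow> sat S s' \<phi>"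
proof (induction \<phi> arbitrary: s s')
  case (Eq t u)
  then have "eval S s t = eval S s' t" "eval S s u = eval S s' u"
    by (auto intro: eval_cong)
  then show ?case by simp
next
  case (Rel r ts)
  then have "map (eval S s) ts = map (eval S s') ts" by (auto intro!: eval_cong)
  then show ?case by (metis sat.simps(2))
next
  case (Neg \<phi>)
  have "sat S s \<phi> \<longleftrightarrow> sat S s' \<phi>" by (rule Neg.IH) (simp add: Neg.prems)
  then show ?case by simp
next
  case (Conj \<phi> \<psi>)
  have "sat S s \<phi> \<longleftrightarrow> sat S s' \<phi>" by (rule Conj.IH(1)) (simp add: Conj.prems)
  moreover have "sat S s \<psi> \<longleftrightarrow> sat S s' \<psi>" by (rule Conj.IH(2)) (simp add: Conj.prems)
  ultimately show ?case by simp
next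
  case (Ex x \<phi>)
  have "sat S (s(x := a)) \<phi> \<longleftrightarrow> sat S (s'(x := a)) \<phi>" for a
    using Ex.prems by (intro Ex.IH) auto
  then show ?case by simp
qed

lemma finite_fv_tm: "finite (fv_tm t)"
  by (induction t) auto

lemma finite_fv: "finite (fv \<phi>)"
  by (induction \<phi>) (auto simp: finite_fv_tm)

primrec ren_tm :: "(nat \<Rightarrow> nat) \<Rightarrow> 'f tm \<Rightarrow> 'f tm" where
  "ren_tm \<rho> (Var x) = Var (\<rho> x)"
| "ren_tm \<rho> (App f ts) = App f (map (ren_tm \<rho>) ts)"

primrec ren :: "(nat \<Rightarrow> nat) \<Rightarrow> ('f, 'r) fm \<Rightarrow> ('f, 'r) fm" where
  "ren \<rho> (Eq t u) = Eq (ren_tm \<rho> t) (ren_tm \<rho> u)"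
| "ren \<rho> (Rel r ts) = Rel r (map (ren_tm \<rho>) ts)"
| "ren \<rho> (Neg \<phi>) = Neg (ren \<rho> \<phi>)"
| "ren \<rho> (Conj \<phi> \<psi>) = Conj (ren \<rho> \<phi>) (ren \<rho> \<psi>)"
| "ren \<rho> (Ex x \<phi>) = Ex (\<rho> x) (ren \<rho> \<phi>)"

lemma wf_ren_tm: "wf_tm L t \<Longrightarrow> wf_tm L (ren_tm \<rho> t)"
  by (induction t) (auto simp: list_all_iff)

lemma wf_ren: "wf_fm L \<phi> \<Longrightarrow> wf_fm L (ren \<rho> \<phi>)"
  by (induction \<phi>) (auto simp: list_all_iff wf_ren_tm)

lemma ren_formulas: "\<phi> \<in> formulas L \<Longrightarrow> ren \<rho> \<phi> \<in> formulas L"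
  by (simp add: formulas_def wf_ren)

lemma eval_ren_tm: "eval S s (ren_tm \<rho> t) = eval S (\<lambda>i. s (\<rho> i)) t"
proof (induction t)
  case (App f ts)
  then have "map (eval S s \<circ> ren_tm \<rho>) ts = map (eval S (\<lambda>i. s (\<rho> i))) ts" by auto
  then show ?case by (simp only: ren_tm.simps eval.simps map_map)
qed simp

text \<open>Injectivity prevents the renamed bound variables from capturing free ones.\<close>

lemma sat_ren:
  assumes "inj \<rho>"
  shows "sat S s (ren \<rho> \<phi>) \<longleftrightarrow> sat S (\<lambda>i. s (\<rho> i)) \<phi>"
proof (induction \<phi> arbitrary: s)
  case (Rel r ts)
  have "eval S s \<circ> ren_tm \<rho> = eval S (\<lambda>i. s (\<rho> i))" by (auto simp: eval_ren_tm)
  then show ?case by simp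
next
  case (Ex x \<phi>)
  have "(\<lambda>i. (s(\<rho> x := a)) (\<rho> i)) = (\<lambda>i. s (\<rho> i))(x := a)" for a
    using assms by (auto simp: inj_eq)
  then show ?case by (simp add: Ex.IH)
qed (auto simp: eval_ren_tm)


section \<open>Definable predicates\<close>

text \<open>
  Even variables of a formula carry the arguments of a definable predicate, odd variables its
  parameters. Predicates are applied to assignments of arguments, with de Bruijn indices, so that
  definability of a concrete predicate is proved by resolution with the rules below.
\<close>

definition mix :: "(nat \<Rightarrow> 'a) \<Rightarrow> (nat \<Rightarrow> 'a) \<Rightarrow> nat \<Rightarrow> 'a" where
  "mix w e i = (if even i then w (i div 2) else e (i div 2))"

text \<open>Agreement with the formula is required only on assignments into the universe, so field
  laws, valid only there, may rewrite \<open>Q\<close>.\<close>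

definition dfn ::
  "('f, 'r) language \<Rightarrow> ('f, 'r, 'a) struct \<Rightarrow> 'a set \<Rightarrow> ((nat \<Rightarrow> 'a) \<Rightarrow> bool) \<Rightarrow> bool" where
  "dfn L S A Q \<longleftrightarrow> (\<exists>\<phi> \<in> formulas L. \<exists>e. range e \<subseteq> A \<and>
     (\<forall>w. range w \<subseteq> univ S \<longrightarrow> (Q w \<longleftrightarrow> sat S (mix w e) \<phi>)))"

lemma mix_even [simp]: "mix w e (2 * i) = w i" and mix_odd [simp]: "mix w e (Suc (2 * i)) = e i"
  and mix_0 [simp]: "mix w e 0 = w 0" and mix_1 [simp]: "mix w e (Suc 0) = e 0"
  by (simp_all add: mix_def)

locale param_struct =
  fixes L :: "('f, 'r) language" and S :: "('f, 'r, 'a) struct" and A :: "'a set"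
  assumes params: "A \<subseteq> univ S" "A \<noteq> {}"
begin

abbreviation D :: "((nat \<Rightarrow> 'a) \<Rightarrow> bool) \<Rightarrow> bool" where
  "D \<equiv> dfn L S A"

lemma D_cong:
  "D Q \<Longrightarrow> (\<And>w. range w \<subseteq> univ S \<Longrightarrow> Q' w \<longleftrightarrow> Q w) \<Longrightarrow> D Q'"
  unfolding dfn_def by (elim bexE exE conjE, intro bexI exI conjI) auto

lemma D_not: "D Q \<Longrightarrow> D (\<lambda>w. \<not> Q w)"
proof -
  assume "D Q"
  then obtain \<phi> e where "\<phi> \<in> formulas L" "range e \<subseteq> A"
    "\<And>w. range w \<subseteq> univ S \<Longrightarrow> Q w \<longleftrightarrow> sat S (mix w e) \<phi>"
    unfolding dfn_def by blast
  then show ?thesis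
    unfolding dfn_def by (intro bexI[of _ "Neg \<phi>"] exI[of _ e]) (auto simp: formulas_def)
qed

lemma D_conj: assumes "D Q" "D Q'" shows "D (\<lambda>w. Q w \<and> Q' w)"
proof -
  obtain \<phi> e where 1: "\<phi> \<in> formulas L" "range e \<subseteq> A"
    "\<And>w. range w \<subseteq> univ S \<Longrightarrow> Q w \<longleftrightarrow> sat S (mix w e) \<phi>"
    using assms unfolding dfn_def by blast
  obtain \<phi>' e' where 2: "\<phi>' \<in> formulas L" "range e' \<subseteq> A"
    "\<And>w. range w \<subseteq> univ S \<Longrightarrow> Q' w \<longleftrightarrow> sat S (mix w e') \<phi>'"
    using assms unfolding dfn_def by blast
  \<comment> \<open>The parameters are interleaved: parameter \<open>k\<close> of the first formula
    becomes number \<open>2 * k\<close>, that of the second number \<open>2 * k + 1\<close>.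
    Argument variables stay fixed.\<close>
  define \<rho> :: "nat \<Rightarrow> nat" where "\<rho> i = (if even i then i else 2 * i - 1)" for i
  define \<rho>' :: "nat \<Rightarrow> nat" where "\<rho>' i = (if even i then i else 2 * i + 1)" for i
  define e'' where "e'' i = (if even i then e (i div 2) else e' (i div 2))" for i :: nat
  have "inj \<rho>"
    by (rule inj_on_inverseI[where g = "\<lambda>j. if even j then j else (j + 1) div 2"])
       (auto simp: \<rho>_def elim!: oddE)
  moreover have "inj \<rho>'"
    by (rule inj_on_inverseI[where g = "\<lambda>j. if even j then j else j div 2"])
       (auto simp: \<rho>'_def elim!: oddE)
  ultimately have inj: "inj \<rho>" "inj \<rho>'" .
  have "mix w e'' (\<rho> i) = mix w e i \<and> mix w e'' (\<rho>' i) = mix w e' i" for w i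
  proof (cases "even i")
    case True
    then show ?thesis by (simp add: mix_def \<rho>_def \<rho>'_def)
  next
    case False
    then obtain k where "i = Suc (2 * k)" by (auto elim: oddE)
    then have "\<rho> i = Suc (2 * (2 * k))" "\<rho>' i = Suc (2 * Suc (2 * k))" "mix w e i = e k"
      "mix w e' i = e' k" by (simp_all add: \<rho>_def \<rho>'_def)
    then show ?thesis by (simp only: mix_odd) (simp add: e''_def)
  qed
  then have "sat S (mix w e'') (Conj (ren \<rho> \<phi>) (ren \<rho>' \<phi>')) \<longleftrightarrow>
      sat S (mix w e) \<phi> \<and> sat S (mix w e') \<phi>'" for w
    by (simp add: sat_ren inj)
  moreover have "Conj (ren \<rho> \<phi>) (ren \<rho>' \<phi>') \<in> formulas L"
    using 1(1) 2(1) by (simp add: formulas_def wf_ren)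
  moreover have "range e'' \<subseteq> A" using 1(2) 2(2) by (auto simp: e''_def)
  ultimately show ?thesis unfolding dfn_def using 1(3) 2(3) by blast
qed

lemma D_ren: assumes "D Q" "inj \<sigma>" shows "D (\<lambda>w. Q (\<lambda>i. w (\<sigma> i)))"
proof -
  obtain \<phi> e where 1: "\<phi> \<in> formulas L" "range e \<subseteq> A"
    "\<And>w. range w \<subseteq> univ S \<Longrightarrow> Q w \<longleftrightarrow> sat S (mix w e) \<phi>"
    using assms unfolding dfn_def by blast
  define \<rho> :: "nat \<Rightarrow> nat" where "\<rho> i = (if even i then 2 * \<sigma> (i div 2) else i)" for i
  have inj: "inj \<rho>"
    by (rule inj_on_inverseI[where g = "\<lambda>j. if even j then 2 * inv_into UNIV \<sigma> (j div 2) else j"])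
       (simp add: \<rho>_def inv_f_f[OF assms(2)])
  have eq: "(\<lambda>i. mix w e (\<rho> i)) = mix (\<lambda>i. w (\<sigma> i)) e" for w
    by (auto simp: mix_def \<rho>_def)
  have "Q (\<lambda>i. w (\<sigma> i)) \<longleftrightarrow> sat S (mix w e) (ren \<rho> \<phi>)" if "range w \<subseteq> univ S" for w
    using that by (subst 1(3)) (auto simp: sat_ren inj eq)
  then show ?thesis
    unfolding dfn_def using ren_formulas[OF 1(1)] 1(2) by blast
qed

lemma D_ex_env:
  assumes "D Q"
  shows "D (\<lambda>w. \<exists>a\<in>univ S. Q (case_nat a w))"
proof -
  obtain \<phi> e where 1: "\<phi> \<in> formulas L" "range e \<subseteq> A"
    "\<And>w. range w \<subseteq> univ S \<Longrightarrow> Q w \<longleftrightarrow> sat S (mix w e) \<phi>"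
    using assms unfolding dfn_def by blast
  \<comment> \<open>Argument 0 moves to variable 1, where \<open>Ex 1\<close> binds it. The other
    arguments move down to close the gap, the parameters move up to vacate 1; \<open>e' 0\<close> is
    a filler hidden by the quantifier.\<close>
  define \<rho> :: "nat \<Rightarrow> nat" where
    "\<rho> i = (if i = 0 then 1 else if even i then i - 2 else i + 2)" for i
  define e' where "e' i = (case i of 0 \<Rightarrow> e 0 | Suc k \<Rightarrow> e k)" for i
  have inj: "inj \<rho>"
    by (rule inj_on_inverseI[where g = "\<lambda>j. if j = 1 then 0 else if even j then j + 2 else j - 2"])
       (auto simp: \<rho>_def elim!: evenE oddE; presburger)
  have eq: "(\<lambda>i. ((mix w e')(1 := a)) (\<rho> i)) = mix (case_nat a w) e" for w a
  proof
    fix i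
    show "((mix w e')(1 := a)) (\<rho> i) = mix (case_nat a w) e i"
    proof (cases "even i")
      case True
      then obtain k where "i = 2 * k" by blast
      then show ?thesis by (cases k) (auto simp: mix_def \<rho>_def)
    next
      case False
      then obtain k where "i = 2 * k + 1" by (blast elim: oddE)
      then show ?thesis by (auto simp: mix_def \<rho>_def e'_def)
    qed
  qed
  have "(\<exists>a\<in>univ S. Q (case_nat a w)) \<longleftrightarrow> sat S (mix w e') (Ex 1 (ren \<rho> \<phi>))"
    if "range w \<subseteq> univ S" for w
  proof -
    have "Q (case_nat a w) \<longleftrightarrow> sat S ((mix w e')(1 := a)) (ren \<rho> \<phi>)" if "a \<in> univ S" for a
    proof -
      have "range (case_nat a w) \<subseteq> univ S"
        using that \<open>range w \<subseteq> univ S\<close> by (auto simp: image_subset_iff split: nat.splits)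
      then show ?thesis by (simp only: 1(3) sat_ren[OF inj] eq)
    qed
    then show ?thesis by auto
  qed
  moreover have "Ex 1 (ren \<rho> \<phi>) \<in> formulas L"
    using 1(1) by (simp add: formulas_def wf_ren)
  moreover have "range e' \<subseteq> A" using 1(2) by (auto simp: e'_def split: nat.splits)
  ultimately show ?thesis unfolding dfn_def by blast
qed

lemma D_ex:
  assumes "D (\<lambda>w. Q (\<lambda>i. w (Suc i)) (w 0))"
  shows "D (\<lambda>w. \<exists>a\<in>univ S. Q w a)"
  using D_ex_env[OF assms] by simp

lemma D_disj: assumes "D Q" "D Q'" shows "D (\<lambda>w. Q w \<or> Q' w)"
  by (rule D_cong[OF D_not[OF D_conj[OF D_not[OF assms(1)] D_not[OF assms(2)]]]]) simp

lemma D_imp: assumes "D Q" "D Q'" shows "D (\<lambda>w. Q w \<longrightarrow> Q' w)"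
  by (rule D_cong[OF D_not[OF D_conj[OF assms(1) D_not[OF assms(2)]]]]) simp

lemma D_all:
  assumes "D (\<lambda>w. Q (\<lambda>i. w (Suc i)) (w 0))"
  shows "D (\<lambda>w. \<forall>a\<in>univ S. Q w a)"
  by (rule D_cong[OF D_not[OF D_ex[of "\<lambda>w a. \<not> Q w a", OF D_not[OF assms]]]]) simp

lemma D_var_eq: "D (\<lambda>w. w i = w j)"
proof -
  obtain a where "a \<in> A" using params by blast
  then show ?thesis
    unfolding dfn_def
    by (intro bexI[of _ "Eq (Var (2 * i)) (Var (2 * j))"] exI[of _ "\<lambda>_. a"])
       (auto simp: formulas_def)
qed

lemma D_const_eq: "c \<in> A \<Longrightarrow> D (\<lambda>w. w i = c)"
  unfolding dfn_def
  by (intro bexI[of _ "Eq (Var (2 * i)) (Var 1)"] exI[of _ "\<lambda>_. c"])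
     (auto simp: formulas_def)

lemma D_fun2: assumes "(f, 2) \<in> Funs L" shows "D (\<lambda>w. w i = fun_int S f [w j, w k])"
proof -
  obtain a where a: "a \<in> A" using params by blast
  let ?\<phi> = "Eq (Var (2 * i)) (App f [Var (2 * j), Var (2 * k)]) :: ('f, 'r) fm"
  have "?\<phi> \<in> formulas L" using assms by (simp add: formulas_def numeral_2_eq_2)
  moreover have "sat S (mix w (\<lambda>_. a)) ?\<phi> \<longleftrightarrow> w i = fun_int S f [w j, w k]" for w
    by (simp only: sat.simps eval.simps list.map mix_even)
  moreover have "range (\<lambda>_. a) \<subseteq> A" using a by auto
  ultimately show ?thesis
    unfolding dfn_def by (intro bexI[of _ ?\<phi>] exI[of _ "\<lambda>_. a"] conjI allI impI) simp_all
qed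

lemma D_sat2:
  assumes "\<theta> \<in> pformulas L 2 A"
  shows "D (\<lambda>w. sat2 S \<theta> (w 1) (w 0))"
proof -
  obtain \<phi> s where \<theta>: "\<theta> = (\<phi>, s)" "\<phi> \<in> formulas L" "\<And>x. x \<in> fv \<phi> \<Longrightarrow> 2 \<le> x \<Longrightarrow> s x \<in> A"
    using assms by (auto simp: pformulas_def)
  obtain a where a: "a \<in> A" using params by blast
  \<comment> \<open>The first object variable becomes argument 1, the second argument 0, all others
    parameters. The default \<open>a\<close> in \<open>e\<close> is never taken at a free parameter
    variable.\<close>
  define \<rho> :: "nat \<Rightarrow> nat" where
    "\<rho> i = (if i = 0 then 2 else if i = 1 then 0 else 2 * i + 1)" for i
  define e where "e i = (if s i \<in> A then s i else a)" for i
  have inj: "inj \<rho>"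
    by (rule inj_on_inverseI[where g = "\<lambda>j. if j = 2 then 0 else if j = 0 then 1 else j div 2"])
       (simp add: \<rho>_def)
  have "sat2 S \<theta> (w 1) (w 0) \<longleftrightarrow> sat S (mix w e) (ren \<rho> \<phi>)" for w
    unfolding \<theta>(1) sat2.simps sat_ren[OF inj]
  proof (rule sat_cong)
    fix x assume "x \<in> fv \<phi>"
    then show "(s(0 := w 1, 1 := w 0)) x = mix w e (\<rho> x)"
      using \<theta>(3)[of x] by (cases "x < 2") (auto simp: mix_def \<rho>_def e_def)
  qed
  then show ?thesis
    unfolding dfn_def using ren_formulas[OF \<theta>(2)] a
    by (intro bexI[of _ "ren \<rho> \<phi>"] exI[of _ e]) (auto simp: e_def)
qed

lemma D_sat1_ex:
  assumes "D (\<lambda>w. X (w 0))"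
  shows "\<exists>\<theta> \<in> pformulas L 1 A. \<forall>a\<in>univ S. sat1 S \<theta> a \<longleftrightarrow> X a"
proof -
  obtain \<phi> e where 1: "\<phi> \<in> formulas L" "range e \<subseteq> A"
    "\<And>w. range w \<subseteq> univ S \<Longrightarrow> X (w 0) \<longleftrightarrow> sat S (mix w e) \<phi>"
    using assms unfolding dfn_def by blast
  obtain c where c: "c \<in> A" using params by blast
  \<comment> \<open>Argument variables other than 0 may still occur in \<open>\<phi>\<close>; they
    count as parameters and receive the value \<open>c\<close>.\<close>
  have eq: "(mix (\<lambda>_. c) e)(0 := a) = mix ((\<lambda>_. c)(0 := a)) e" for a
    by (auto simp: fun_eq_iff mix_def elim!: evenE)
  have "sat1 S (\<phi>, mix (\<lambda>_. c) e) a \<longleftrightarrow> X a" if "a \<in> univ S" for a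
    using that c params by (simp add: eq 1(3)[of "(\<lambda>_. c)(0 := a)", symmetric] image_subset_iff subsetD)
  moreover have "(\<phi>, mix (\<lambda>_. c) e) \<in> pformulas L 1 A"
    using 1 c by (auto simp: pformulas_def mix_def)
  ultimately show ?thesis by blast
qed

text \<open>
  Terms are the definable functions of the assignment, characterized by the substitutions that
  they admit; the renaming makes the notion stable under passing below a quantifier.
\<close>

definition T :: "((nat \<Rightarrow> 'a) \<Rightarrow> 'a) \<Rightarrow> bool" where
  "T t \<longleftrightarrow> (\<forall>w. range w \<subseteq> univ S \<longrightarrow> t w \<in> univ S) \<and>
     (\<forall>\<rho> Q. D (\<lambda>w. Q (\<lambda>i. w (Suc i)) (w 0)) \<longrightarrow> D (\<lambda>w. Q w (t (\<lambda>i. w (\<rho> i)))))"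

lemma T_subst: "T t \<Longrightarrow> D (\<lambda>w. Q (\<lambda>i. w (Suc i)) (w 0)) \<Longrightarrow> D (\<lambda>w. Q w (t (\<lambda>i. w (\<rho> i))))"
  by (simp add: T_def)

lemma T_subst0: "T t \<Longrightarrow> D (\<lambda>w. Q (\<lambda>i. w (Suc i)) (w 0)) \<Longrightarrow> D (\<lambda>w. Q w (t w))"
  using T_subst[of t Q "\<lambda>i. i"] by simp

text \<open>Substituting a variable that may occur elsewhere in \<open>Q\<close> identifies two
  variables, which the injective \<open>D_ren\<close> cannot do; a quantifier with an equation
  can.\<close>

lemma T_var: "T (\<lambda>w. w i)"
proof -
  have "D (\<lambda>w. Q w (w j))" if "D (\<lambda>w. Q (\<lambda>i. w (Suc i)) (w 0))" for Q j
  proof (rule D_cong[OF D_ex[of "\<lambda>w a. a = w j \<and> Q w a"]])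
    show "D (\<lambda>w. w 0 = w (Suc j) \<and> Q (\<lambda>i. w (Suc i)) (w 0))"
      by (intro D_conj D_var_eq that)
  qed auto
  then show ?thesis by (auto simp: T_def)
qed

lemma T_const: "c \<in> A \<Longrightarrow> T (\<lambda>w. c)"
proof -
  assume c: "c \<in> A"
  have "D (\<lambda>w. Q w c)" if "D (\<lambda>w. Q (\<lambda>i. w (Suc i)) (w 0))" for Q
  proof (rule D_cong[OF D_ex[of "\<lambda>w a. a = c \<and> Q w a"]])
    show "D (\<lambda>w. w 0 = c \<and> Q (\<lambda>i. w (Suc i)) (w 0))"
      by (intro D_conj D_const_eq that c)
  qed (use c params in auto)
  then show ?thesis using c params by (auto simp: T_def)
qed

lemma T_op:
  assumes "\<And>x y. x \<in> univ S \<Longrightarrow> y \<in> univ S \<Longrightarrow> g x y \<in> univ S"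
    and g: "D (\<lambda>w. w 0 = g (w 2) (w 1))"
    and "T t" "T u"
  shows "T (\<lambda>w. g (t w) (u w))"
proof -
  have "D (\<lambda>w. Q w (g (t (\<lambda>i. w (\<rho> i))) (u (\<lambda>i. w (\<rho> i)))))"
    if Q: "D (\<lambda>w. Q (\<lambda>i. w (Suc i)) (w 0))" for Q \<rho>
  proof (rule T_subst[OF \<open>T t\<close>, where Q = "\<lambda>w a. Q w (g a (u (\<lambda>i. w (\<rho> i))))"])
    show "D (\<lambda>w. Q (\<lambda>i. w (Suc i)) (g (w 0) (u (\<lambda>i. w (Suc (\<rho> i))))))"
    proof (rule T_subst[OF \<open>T u\<close>, where Q = "\<lambda>w b. Q (\<lambda>i. w (Suc i)) (g (w 0) b)"
          and \<rho> = "\<lambda>i. Suc (\<rho> i)"])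
      show "D (\<lambda>w. Q (\<lambda>i. w (Suc (Suc i))) (g (w (Suc 0)) (w 0)))"
      proof (rule D_cong[OF D_ex[of "\<lambda>w c. c = g (w 1) (w 0) \<and> Q (\<lambda>i. w (Suc (Suc i))) c"]])
        \<comment> \<open>The value stays at index 0, and indices 1 and 2 are freed for the
          arguments of \<open>g\<close>.\<close>
        have "inj (\<lambda>i. if i = 0 then 0 else i + 2 :: nat)"
          by (auto simp: inj_on_def)
        from D_ren[OF Q this]
        have "D (\<lambda>w. Q (\<lambda>i. w (Suc (Suc (Suc i)))) (w 0))"
          by simp
        with g show "D (\<lambda>w. w 0 = g (w (Suc 1)) (w (Suc 0)) \<and> Q (\<lambda>i. w (Suc (Suc (Suc i)))) (w 0))"
          by (intro D_conj) (simp_all add: numeral_2_eq_2)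
      qed (use assms(1) in \<open>auto simp: image_subset_iff\<close>)
    qed
  qed
  then show ?thesis using assms(1,3,4) by (auto simp: T_def)
qed

lemma D_rel:
  assumes "D (\<lambda>w. R (w 1) (w 0))" "T t" "T u"
  shows "D (\<lambda>w. R (t w) (u w))"
proof (rule T_subst0[OF \<open>T t\<close>, where Q = "\<lambda>w a. R a (u w)"])
  show "D (\<lambda>w. R (w 0) (u (\<lambda>i. w (Suc i))))"
    by (rule T_subst[OF \<open>T u\<close>, where Q = "\<lambda>w b. R (w 0) b"]) (use assms in simp)
qed

lemma D_eq: "T t \<Longrightarrow> T u \<Longrightarrow> D (\<lambda>w. t w = u w)"
  by (rule D_rel[where R = "(=)", OF D_var_eq])

lemma D_mem_finite:
  assumes "finite E" "E \<subseteq> A" "T t"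
  shows "D (\<lambda>w. t w \<in> E)"
  using assms(1,2)
proof (induction E)
  case empty
  show ?case using D_not[OF D_var_eq[of 0 0]] by simp
next
  case (insert x E)
  then show ?case
    using D_disj[OF D_eq[OF \<open>T t\<close> T_const[of x]]] by simp
qed

lemmas D_intros = D_not D_conj D_disj D_imp D_ex D_all D_eq T_var T_const

end

section \<open>Definable preorders on a minimal field\<close>

text \<open>Each fibre contains some \<open>y\<close> together with its distinct partner
  \<open>s y\<close>; summing the fibre sizes gives the factor two.\<close>

lemma two_card_image_le:
  assumes "finite X" and "\<And>y. y \<in> X \<Longrightarrow> s y \<in> X \<and> s y \<noteq> y \<and> f (s y) = f y"
  shows "2 * card (f ` X) \<le> card X"
proof -
  have "2 \<le> card {y \<in> X. f y = z}" if "z \<in> f ` X" for z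
  proof -
    obtain y where "y \<in> X" "z = f y" using \<open>z \<in> f ` X\<close> by blast
    then have "{y, s y} \<subseteq> {y \<in> X. f y = z}" "card {y, s y} = 2"
      using assms(2)[of y] by auto
    then show ?thesis using card_mono[of "{y \<in> X. f y = z}" "{y, s y}"] assms(1) by simp
  qed
  then have "(\<Sum>z\<in>f ` X. 2) \<le> (\<Sum>z\<in>f ` X. card {y \<in> X. f y = z})"
    by (rule sum_mono)
  also have "\<dots> = card X"
    using sum.image_gen[OF assms(1), of "\<lambda>_. 1 :: nat" f] by simp
  finally show ?thesis by simp
qed

lemma finite_preimage_fibers:
  assumes "finite B" and "\<And>z. z \<in> B \<Longrightarrow> finite {y \<in> Y. f y = z}"
  shows "finite {y \<in> Y. f y \<in> B}"
proof -
  have "{y \<in> Y. f y \<in> B} = (\<Union>z\<in>B. {y \<in> Y. f y = z})" by auto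
  then show ?thesis using assms by simp
qed

section \<open>The almost surjective two-to-one map of a minimal field\<close>

locale minimal_field_struct = param_struct L S "univ S" + field R
  for L :: "('f, 'r) language" and S :: "('f, 'r, 'a) struct" and R :: "'a ring" (structure) +
  assumes carrier_eq: "carrier R = univ S"
    and D_add: "D (\<lambda>w. w 0 = w 2 \<oplus> w 1)"
    and D_mult: "D (\<lambda>w. w 0 = w 2 \<otimes> w 1)"
    and infinite_univ: "infinite (univ S)"
    and minimality: "D (\<lambda>w. X (w 0)) \<Longrightarrow> finite {a \<in> univ S. X a} \<or> finite {a \<in> univ S. \<not> X a}"
begin

lemma T_add: "T t \<Longrightarrow> T u \<Longrightarrow> T (\<lambda>w. t w \<oplus> u w)"
  using D_add by (rule T_op[rotated]) (auto simp flip: carrier_eq)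

lemma T_mult: "T t \<Longrightarrow> T u \<Longrightarrow> T (\<lambda>w. t w \<otimes> u w)"
  using D_mult by (rule T_op[rotated]) (auto simp flip: carrier_eq)

lemma cofinite_of_infinite:
  "infinite {a \<in> univ S. X a} \<Longrightarrow> D (\<lambda>w. X (w 0)) \<Longrightarrow> finite {a \<in> univ S. \<not> X a}"
  using minimality by blast

lemma ex_notin: "finite F \<Longrightarrow> \<exists>x\<in>univ S. x \<notin> F"
  using infinite_univ by (meson finite_subset subsetI)

text \<open>
  The map \<open>sq y = y\<^sup>2 + y\<close> is two-to-one in every characteristic, its fibres being the orbits of
  the involution \<open>mirror y = - 1 - y\<close>.
\<close>

definition sq :: "'a \<Rightarrow> 'a" where "sq y = y \<otimes> y \<oplus> y"
definition mirror :: "'a \<Rightarrow> 'a" where "mirror y = \<ominus> \<one> \<oplus> \<ominus> \<one> \<otimes> y"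

lemma T_sq: "T t \<Longrightarrow> T (\<lambda>w. sq (t w))"
  unfolding sq_def by (intro T_add T_mult)

lemma T_mirror: "T t \<Longrightarrow> T (\<lambda>w. mirror (t w))"
  unfolding mirror_def by (intro T_add T_mult T_const) (auto simp flip: carrier_eq)

lemma sq_closed: "y \<in> univ S \<Longrightarrow> sq y \<in> univ S"
  by (simp add: sq_def flip: carrier_eq)

lemma mirror_closed: "y \<in> univ S \<Longrightarrow> mirror y \<in> univ S"
  by (simp add: mirror_def flip: carrier_eq)

lemma mirror_mirror: "y \<in> univ S \<Longrightarrow> mirror (mirror y) = y"
  unfolding mirror_def carrier_eq[symmetric] by algebra

lemma sq_mirror: "y \<in> univ S \<Longrightarrow> sq (mirror y) = sq y"
  unfolding mirror_def sq_def carrier_eq[symmetric] by algebra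

lemma inj_mirror: "inj_on mirror (univ S)"
  by (metis inj_onI mirror_mirror)

lemma eq_of_minus_zero: "z \<ominus> y = \<zero> \<Longrightarrow> y \<in> carrier R \<Longrightarrow> z \<in> carrier R \<Longrightarrow> z = y"
proof -
  assume "z \<ominus> y = \<zero>" and c: "y \<in> carrier R" "z \<in> carrier R"
  moreover have "z = (z \<ominus> y) \<oplus> y" using c by algebra
  ultimately show ?thesis by simp
qed

lemma sq_eqD:
  assumes "y \<in> univ S" "z \<in> univ S" "sq z = sq y"
  shows "z = y \<or> z = mirror y"
proof -
  have yz: "y \<in> carrier R" "z \<in> carrier R" using assms carrier_eq by auto
  have "(z \<ominus> y) \<otimes> (z \<oplus> y \<oplus> \<one>) = sq z \<ominus> sq y"
    using yz unfolding sq_def by algebra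
  also have "\<dots> = \<zero>" using assms(3) yz by (simp add: sq_def a_minus_def r_neg)
  finally have "z \<ominus> y = \<zero> \<or> z \<oplus> y \<oplus> \<one> = \<zero>" using yz by (simp add: integral_iff)
  then show ?thesis
  proof
    assume "z \<ominus> y = \<zero>"
    then show ?thesis using yz eq_of_minus_zero by blast
  next
    assume *: "z \<oplus> y \<oplus> \<one> = \<zero>"
    have "z = (z \<oplus> y \<oplus> \<one>) \<oplus> mirror y" using yz unfolding mirror_def by algebra
    then show ?thesis using * yz by (simp add: mirror_def)
  qed
qed

lemma finite_sq_fiber: "finite {y \<in> univ S. sq y = z}"
proof (cases "\<exists>y\<in>univ S. sq y = z")
  case True
  then obtain y where "y \<in> univ S" "sq y = z" by blast
  then have "{y \<in> univ S. sq y = z} \<subseteq> {y, mirror y}" using sq_eqD[of y] by auto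
  then show ?thesis using finite_subset by blast
next
  case False
  then have "{y \<in> univ S. sq y = z} = {}" by blast
  then show ?thesis by (simp only: finite.emptyI)
qed

lemma infinite_sq_image:
  assumes "infinite Y" "Y \<subseteq> univ S" shows "infinite (sq ` Y)"
proof
  assume "finite (sq ` Y)"
  then have "finite {y \<in> univ S. sq y \<in> sq ` Y}"
    by (rule finite_preimage_fibers) (rule finite_sq_fiber)
  moreover have "Y \<subseteq> {y \<in> univ S. sq y \<in> sq ` Y}" using assms(2) by blast
  ultimately show False using assms(1) finite_subset by meson
qed

text \<open>Finite fibres make the image of \<open>sq\<close> infinite; being definable, it is
  cofinite.\<close>

lemma finite_sq_nonimage: "finite {z \<in> univ S. \<not> (\<exists>y\<in>univ S. sq y = z)}"
proof (rule cofinite_of_infinite)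
  show "infinite {z \<in> univ S. \<exists>y\<in>univ S. sq y = z}"
  proof (rule infinite_super)
    show "infinite (sq ` univ S)" using infinite_sq_image infinite_univ by blast
  qed (use sq_closed in auto)
  show "D (\<lambda>w. \<exists>y\<in>univ S. sq y = w 0)" by (intro D_intros T_sq)
qed

text \<open>A fixed point solves 1 + 2y = 0, which has no solution in characteristic 2 and a single
  one otherwise.\<close>

lemma finite_mirror_fixed: "finite {y \<in> univ S. mirror y = y}"
proof -
  have fixed: "y = z" if yz: "y \<in> univ S" "z \<in> univ S" "mirror y = y" "mirror z = z" for y z
  proof -
    have c: "y \<in> carrier R" "z \<in> carrier R" using yz carrier_eq by auto
    have 1: "\<one> \<oplus> (\<one> \<oplus> \<one>) \<otimes> y = y \<ominus> mirror y" "\<one> \<oplus> (\<one> \<oplus> \<one>) \<otimes> z = z \<ominus> mirror z"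
      using c unfolding mirror_def by algebra+
    then have 0: "\<one> \<oplus> (\<one> \<oplus> \<one>) \<otimes> y = \<zero>" "\<one> \<oplus> (\<one> \<oplus> \<one>) \<otimes> z = \<zero>"
      using c yz by (simp_all add: a_minus_def r_neg)
    have "(\<one> \<oplus> \<one>) \<otimes> (y \<ominus> z) = (\<one> \<oplus> (\<one> \<oplus> \<one>) \<otimes> y) \<ominus> (\<one> \<oplus> (\<one> \<oplus> \<one>) \<otimes> z)"
      using c by algebra
    then have "(\<one> \<oplus> \<one>) \<otimes> (y \<ominus> z) = \<zero>" using 0 by (simp add: a_minus_def)
    moreover have "\<one> \<oplus> \<one> \<noteq> \<zero>" using 0 c by auto
    ultimately have "y \<ominus> z = \<zero>" using c by (simp add: integral_iff)
    then show ?thesis using c eq_of_minus_zero by blast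
  qed
  show ?thesis
  proof (cases "\<exists>y\<in>univ S. mirror y = y")
    case True
    then obtain z where "z \<in> univ S" "mirror z = z" by blast
    then have "{y \<in> univ S. mirror y = y} \<subseteq> {z}" using fixed by blast
    then show ?thesis using finite_subset by blast
  next
    case False
    then have "{y \<in> univ S. mirror y = y} = {}" by blast
    then show ?thesis by (simp only: finite.emptyI)
  qed
qed

end

section \<open>Definable total preorders with finite classes\<close>

locale def_preorder = minimal_field_struct L S R
  for L :: "('f, 'r) language" and S :: "('f, 'r, 'a) struct" and R :: "'a ring" (structure) +
  fixes le :: "'a \<Rightarrow> 'a \<Rightarrow> bool"
  assumes D_le': "D (\<lambda>w. le (w 1) (w 0))"
    and total: "x \<in> univ S \<Longrightarrow> y \<in> univ S \<Longrightarrow> le x y \<or> le y x"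
    and trans: "le x y \<Longrightarrow> le y z \<Longrightarrow> x \<in> univ S \<Longrightarrow> y \<in> univ S \<Longrightarrow> z \<in> univ S \<Longrightarrow> le x z"
    and finite_class: "a \<in> univ S \<Longrightarrow> finite {x \<in> univ S. le x a \<and> le a x}"
begin

lemma le_refl: "x \<in> univ S \<Longrightarrow> le x x"
  using total by blast

lemma D_le: "T t \<Longrightarrow> T u \<Longrightarrow> D (\<lambda>w. le (t w) (u w))"
  by (rule D_rel[OF D_le'])

lemma ex_max:
  "finite F \<Longrightarrow> F \<noteq> {} \<Longrightarrow> F \<subseteq> univ S \<Longrightarrow> \<exists>m\<in>F. \<forall>x\<in>F. le x m"
proof (induction F rule: finite_ne_induct)
  case (singleton x)
  then show ?case using le_refl by simp
next
  case (insert x F)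
  then obtain m where m: "m \<in> F" "\<forall>x\<in>F. le x m" by blast
  have in_U: "x \<in> univ S" "F \<subseteq> univ S" using insert.prems by auto
  show ?case
  proof (cases "le x m")
    case True
    then show ?thesis using m by blast
  next
    case False
    then have "le m x" using total[of x m] in_U m by blast
    then have "\<forall>y\<in>insert x F. le y x" using trans[of _ m x] m in_U le_refl[of x] by blast
    then show ?thesis by blast
  qed
qed

text \<open>The involution exchanges the elements strictly below their image with those strictly
  above it. These definable sets are disjoint and equinumerous, so neither can be cofinite.\<close>

lemma finite_mirror_not_equiv: "finite {y \<in> univ S. \<not> (le y (mirror y) \<and> le (mirror y) y)}"
proof -
  let ?up = "{y \<in> univ S. \<not> le (mirror y) y}" and ?down = "{y \<in> univ S. \<not> le y (mirror y)}"
  have down: "?down = mirror ` ?up"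
  proof
    show "mirror ` ?up \<subseteq> ?down" by (auto simp: mirror_mirror mirror_closed)
    show "?down \<subseteq> mirror ` ?up"
    proof
      fix y assume "y \<in> ?down"
      then have "mirror y \<in> ?up" "y = mirror (mirror y)" by (auto simp: mirror_mirror mirror_closed)
      then show "y \<in> mirror ` ?up" by blast
    qed
  qed
  have "finite ?up"
  proof (rule ccontr)
    assume inf: "infinite ?up"
    have "finite {y \<in> univ S. \<not> \<not> le (mirror y) y}"
      by (rule cofinite_of_infinite[OF inf]) (intro D_intros D_le T_mirror)
    moreover have "?down \<subseteq> {y \<in> univ S. \<not> \<not> le (mirror y) y}"
      using total mirror_closed by blast
    ultimately have "finite ?down" by (meson finite_subset)
    then have "finite (mirror ` ?up)" by (simp only: down)
    moreover have "inj_on mirror ?up" by (rule inj_on_subset[OF inj_mirror]) blast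
    ultimately show False using inf finite_imageD by meson
  qed
  then have "finite (?up \<union> ?down)" using down by simp
  moreover have "{y \<in> univ S. \<not> (le y (mirror y) \<and> le (mirror y) y)} = ?up \<union> ?down" by blast
  ultimately show ?thesis by simp
qed

text \<open>
  Otherwise \<open>sq\<close> would map almost every class to itself, surjectively by minimality but not
  injectively, although classes are finite.
\<close>

lemma finite_sq_equiv: "finite {y \<in> univ S. le y (sq y) \<and> le (sq y) y}" (is "finite ?Y")
proof (rule ccontr)
  assume inf: "infinite ?Y"
  let ?X = "\<lambda>x. \<exists>y\<in>univ S. sq y = x \<and> le x y \<and> le y x"
  have "finite {x \<in> univ S. \<not> ?X x}"
  proof (rule cofinite_of_infinite)
    have "sq ` ?Y \<subseteq> {x \<in> univ S. ?X x}" by (auto simp: sq_closed)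
    then show "infinite {x \<in> univ S. ?X x}"
      using infinite_sq_image[OF inf] infinite_super by blast
    show "D (\<lambda>w. ?X (w 0))" by (intro D_intros D_le T_sq)
  qed
  then have fin: "finite ({x \<in> univ S. \<not> ?X x} \<union> {y \<in> univ S. mirror y = y}
      \<union> {y \<in> univ S. \<not> (le y (mirror y) \<and> le (mirror y) y)})" (is "finite ?B")
    using finite_mirror_fixed finite_mirror_not_equiv by simp
  \<comment> \<open>The whole classes of exceptional elements are discarded, so that the class
    \<open>C\<close> of a remaining \<open>x\<close> contains no exception at all.\<close>
  then have "finite (\<Union>b\<in>?B. {x \<in> univ S. le x b \<and> le b x})"
    by (rule finite_UN_I) (use finite_class in blast)
  then obtain x where x: "x \<in> univ S" "x \<notin> (\<Union>b\<in>?B. {x \<in> univ S. le x b \<and> le b x})"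
    using ex_notin by blast
  define C where "C = {y \<in> univ S. le y x \<and> le x y}"
  have C: "y \<notin> ?B" if "y \<in> C" for y
    using that x unfolding C_def by blast
  have xC: "x \<in> C" using x le_refl by (simp add: C_def)
  have "C \<subseteq> sq ` C"
  proof
    fix z assume z: "z \<in> C"
    then have "z \<in> univ S" "?X z" using C[OF z] by (auto simp: C_def)
    then obtain y where y: "y \<in> univ S" "sq y = z" "le z y" "le y z" by blast
    then have "y \<in> C" using z x(1) trans unfolding C_def by blast
    then show "z \<in> sq ` C" using y by blast
  qed
  then have "inj_on sq C"
    using finite_class[OF x(1)] by (intro finite_surj_inj) (simp_all add: C_def)
  moreover have "mirror x \<in> C" "mirror x \<noteq> x"
    using C[OF xC] x(1) mirror_closed by (auto simp: C_def)
  ultimately show False using sq_mirror[OF x(1)] xC by (auto dest: inj_onD)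
qed

text \<open>
  If almost every \<open>sq y\<close> were above \<open>y\<close>, then almost all of a finite initial segment would be the
  image of its elements, of which only half as many are available.
\<close>

lemma finite_sq_above:
  assumes inf: "infinite {a \<in> univ S. finite {x \<in> univ S. le x a}}"
  shows "finite {y \<in> univ S. \<not> le (sq y) y}"
proof (rule ccontr)
  assume "infinite {y \<in> univ S. \<not> le (sq y) y}"
  then have fin0: "finite {y \<in> univ S. \<not> \<not> le (sq y) y}"
    by (rule cofinite_of_infinite) (intro D_intros D_le T_sq)
  define E1 where "E1 = {y \<in> univ S. le (sq y) y}"
  from fin0 have fin1: "finite E1" by (simp add: E1_def)
  define E where "E = {z \<in> univ S. \<not> (\<exists>y\<in>univ S. sq y = z)}"
  define E2 where "E2 = {y \<in> univ S. \<not> (le y (mirror y) \<and> le (mirror y) y)} \<union> {y \<in> univ S. mirror y = y}"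
  have fin: "finite E" "finite E2"
    using finite_sq_nonimage finite_mirror_fixed finite_mirror_not_equiv
    by (simp_all add: E_def E2_def)
  \<comment> \<open>Below, \<open>B\<close> is covered by \<open>E\<close> and the images of
    \<open>E1\<close>, \<open>E2\<close> and \<open>B - E2\<close>, the last having at most half the
    size of \<open>B\<close>. So \<open>card B\<close> is at most twice the sum of the other three
    sizes; \<open>?k\<close> is one more.\<close>
  let ?k = "2 * card E + 2 * card E1 + 2 * card E2 + 1"
  \<comment> \<open>The maximum \<open>a\<close> of \<open>J\<close> has a finite initial segment
    containing all of \<open>J\<close>, which makes \<open>B\<close> large enough.\<close>
  obtain J where J: "finite J" "card J = ?k" "J \<subseteq> {a \<in> univ S. finite {x \<in> univ S. le x a}}"
    using infinite_arbitrarily_large[OF inf] by blast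
  have "\<exists>m\<in>J. \<forall>x\<in>J. le x m"
  proof (rule ex_max)
    show "J \<noteq> {}" using J(2) by auto
  qed (use J in auto)
  then obtain a where a: "a \<in> J" "\<forall>x\<in>J. le x a" by blast
  define B where "B = {x \<in> univ S. le x a}"
  have aU: "a \<in> univ S" and finB: "finite B" using a J by (auto simp: B_def)
  have "J \<subseteq> B" using a J by (auto simp: B_def)
  then have k: "?k \<le> card B" using card_mono[OF finB] J(2) by metis
  have "2 * card (sq ` (B - E2)) \<le> card (B - E2)"
  proof (rule two_card_image_le)
    fix y assume y: "y \<in> B - E2"
    then have yU: "y \<in> univ S" by (simp add: B_def)
    have "mirror y \<noteq> mirror (mirror y)" using y yU by (auto simp: mirror_mirror E2_def)
    moreover have "le (mirror y) a"
      using y yU aU trans[of "mirror y" y a] mirror_closed by (auto simp: B_def E2_def)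
    ultimately have "mirror y \<in> B - E2"
      using y yU mirror_closed by (auto simp: B_def E2_def mirror_mirror)
    then show "mirror y \<in> B - E2 \<and> mirror y \<noteq> y \<and> sq (mirror y) = sq y"
      using y yU sq_mirror by (auto simp: E2_def)
  qed (use finB in simp)
  also have "\<dots> \<le> card B" by (rule card_mono[OF finB]) blast
  finally have half: "2 * card (sq ` (B - E2)) \<le> card B" .
  have "B \<subseteq> E \<union> (sq ` E1 \<union> (sq ` E2 \<union> sq ` (B - E2)))"
  proof
    fix z assume z: "z \<in> B"
    show "z \<in> E \<union> (sq ` E1 \<union> (sq ` E2 \<union> sq ` (B - E2)))"
    proof (cases "z \<in> E")
      case False
      then obtain y where y: "y \<in> univ S" "sq y = z" using z by (auto simp: B_def E_def)
      have "y \<in> B" if "y \<notin> E1"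
      proof -
        have "le y z" using that y total[of y "sq y"] sq_closed[of y] by (auto simp: E1_def)
        then show ?thesis using y z aU trans[of y z a] by (auto simp: B_def)
      qed
      then show ?thesis using y(2) by blast
    qed simp
  qed
  then have "card B \<le> card (E \<union> (sq ` E1 \<union> (sq ` E2 \<union> sq ` (B - E2))))"
    by (rule card_mono[rotated]) (use fin fin1 finB in simp)
  also have "\<dots> \<le> card E + (card (sq ` E1) + (card (sq ` E2) + card (sq ` (B - E2))))"
    by (intro order_trans[OF card_Un_le] add_mono order_refl)
  also have "\<dots> \<le> card E + (card E1 + (card E2 + card (sq ` (B - E2))))"
    by (intro add_mono order_refl card_image_le fin fin1)
  finally show False using half k by linarith
qed

lemma converse: "def_preorder L S R (\<lambda>x y. le y x)"
proof unfold_locales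
  show "D (\<lambda>w. le (w 0) (w 1))" by (intro D_le T_var)
  show "finite {x \<in> univ S. le a x \<and> le x a}" if "a \<in> univ S" for a
    using finite_class[OF that] by (simp add: conj_commute)
  show "le y x \<or> le x y" if "x \<in> univ S" "y \<in> univ S" for x y
    using total that by auto
  show "le z x" if "le y x" "le z y" "x \<in> univ S" "y \<in> univ S" "z \<in> univ S" for x y z
    using trans[of z y x] that by simp
qed

text \<open>If both sets were infinite, \<open>finite_sq_above\<close> would apply to the order and
  also to its converse, because infinite initial segments are cofinite. Then \<open>sq y\<close>
  would be equivalent to \<open>y\<close> for almost all \<open>y\<close>, against
  \<open>finite_sq_equiv\<close>.\<close>

lemma finite_or_cofinite_initial:
  "finite {a \<in> univ S. infinite {x \<in> univ S. le x a}} \<or>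
   finite {a \<in> univ S. finite {x \<in> univ S. le x a}}"
proof (rule ccontr)
  interpret conv: def_preorder L S R "\<lambda>x y. le y x" by (rule converse)
  assume "\<not> ?thesis"
  then have inf: "infinite {a \<in> univ S. infinite {x \<in> univ S. le x a}}"
    "infinite {a \<in> univ S. finite {x \<in> univ S. le x a}}" by blast+
  have "finite {x \<in> univ S. le a x}" if a: "a \<in> univ S" "infinite {x \<in> univ S. le x a}" for a
  proof -
    have "finite {x \<in> univ S. \<not> le x a}"
      by (rule cofinite_of_infinite[OF a(2)]) (intro D_le T_var T_const a)
    moreover have "{x \<in> univ S. le a x} \<subseteq>
        {x \<in> univ S. \<not> le x a} \<union> {x \<in> univ S. le x a \<and> le a x}" by blast
    ultimately show ?thesis using finite_class[OF a(1)] finite_subset by blast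
  qed
  then have "infinite {a \<in> univ S. finite {x \<in> univ S. le a x}}"
    using inf(1) by (elim infinite_super[rotated]) blast
  then have "finite {y \<in> univ S. \<not> le y (sq y)}" by (rule conv.finite_sq_above)
  then have "finite ({y \<in> univ S. \<not> le y (sq y)} \<union> {y \<in> univ S. \<not> le (sq y) y}
     \<union> {y \<in> univ S. le y (sq y) \<and> le (sq y) y})"
    using finite_sq_above[OF inf(2)] finite_sq_equiv by simp
  moreover have "univ S \<subseteq> {y \<in> univ S. \<not> le y (sq y)} \<union> {y \<in> univ S. \<not> le (sq y) y}
     \<union> {y \<in> univ S. le y (sq y) \<and> le (sq y) y}" by blast
  ultimately show False using infinite_univ finite_subset by blast
qed

end

section \<open>Definable total preorders with finite initial segments\<close>

locale omega_preorder = minimal_field_struct L S R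
  for L :: "('f, 'r) language" and S :: "('f, 'r, 'a) struct" and R :: "'a ring" (structure) +
  fixes le :: "'a \<Rightarrow> 'a \<Rightarrow> bool"
  assumes D_le': "D (\<lambda>w. le (w 1) (w 0))"
    and total: "x \<in> univ S \<Longrightarrow> y \<in> univ S \<Longrightarrow> le x y \<or> le y x"
    and trans: "le x y \<Longrightarrow> le y z \<Longrightarrow> x \<in> univ S \<Longrightarrow> y \<in> univ S \<Longrightarrow> z \<in> univ S \<Longrightarrow> le x z"
    and finite_initial: "a \<in> univ S \<Longrightarrow> finite {x \<in> univ S. le x a}"

sublocale omega_preorder \<subseteq> def_preorder
proof unfold_locales
  show "finite {x \<in> univ S. le x a \<and> le a x}" if "a \<in> univ S" for a
    by (rule finite_subset[OF _ finite_initial[OF that]]) blast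
qed (fact D_le' total trans)+

context def_preorder
begin

text \<open>The exceptions are merged into one lowest class, which is finite and hence
  definable.\<close>

lemma omega_preorder_adjust:
  assumes "finite E" "E \<subseteq> univ S"
    and fin: "\<And>a. a \<in> univ S \<Longrightarrow> a \<notin> E \<Longrightarrow> finite {x \<in> univ S. le x a}"
  shows "omega_preorder L S R (\<lambda>x y. x \<in> E \<or> y \<notin> E \<and> le x y)"
proof unfold_locales
  show "D (\<lambda>w. w 1 \<in> E \<or> w 0 \<notin> E \<and> le (w 1) (w 0))"
    by (intro D_disj D_conj D_not D_le D_mem_finite T_var assms)
next
  fix a assume a: "a \<in> univ S"
  have "finite (E \<union> {x \<in> univ S. a \<notin> E \<and> le x a})"
    using assms(1) fin[OF a] by (cases "a \<in> E") auto
  then show "finite {x \<in> univ S. x \<in> E \<or> a \<notin> E \<and> le x a}"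
    by (rule finite_subset[rotated]) blast
next
  fix x y assume "x \<in> univ S" "y \<in> univ S"
  then show "(x \<in> E \<or> y \<notin> E \<and> le x y) \<or> (y \<in> E \<or> x \<notin> E \<and> le y x)"
    using total[of x y] by auto
next
  fix x y z assume "x \<in> E \<or> y \<notin> E \<and> le x y" "y \<in> E \<or> z \<notin> E \<and> le y z"
    "x \<in> univ S" "y \<in> univ S" "z \<in> univ S"
  then show "x \<in> E \<or> z \<notin> E \<and> le x z" using trans[of x y z] by auto
qed

lemma ex_omega_preorder: "\<exists>le'. omega_preorder L S R le'"
proof -
  let ?I = "{a \<in> univ S. infinite {x \<in> univ S. le x a}}"
  let ?F = "{a \<in> univ S. finite {x \<in> univ S. le x a}}"
  show ?thesis
  proof (cases "finite ?I")
    case True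
    then have "omega_preorder L S R (\<lambda>x y. x \<in> ?I \<or> y \<notin> ?I \<and> le x y)"
      by (rule omega_preorder_adjust) auto
    then show ?thesis by blast
  next
    case False
    then have fin: "finite ?F" using finite_or_cofinite_initial by simp
    interpret conv: def_preorder L S R "\<lambda>x y. le y x" by (rule converse)
    have "omega_preorder L S R (\<lambda>x y. x \<in> ?F \<or> y \<notin> ?F \<and> le y x)"
    proof (rule conv.omega_preorder_adjust[OF fin])
      fix a assume a: "a \<in> univ S" "a \<notin> ?F"
      \<comment> \<open>The initial segment of \<open>a\<close> is infinite, hence cofinite; its
        complement and the class of \<open>a\<close> make up what lies above
        \<open>a\<close>.\<close>
      have "finite {x \<in> univ S. \<not> le x a}"
        by (rule cofinite_of_infinite) (use a in \<open>auto intro!: D_le T_var T_const\<close>)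
      then have "finite ({x \<in> univ S. \<not> le x a} \<union> {x \<in> univ S. le x a \<and> le a x})"
        using finite_class[OF a(1)] by simp
      then show "finite {x \<in> univ S. le a x}" by (rule finite_subset[rotated]) blast
    qed auto
    then show ?thesis by blast
  qed
qed

end

section \<open>Translations, stabilizers and filtrations by subfields\<close>

context omega_preorder
begin

lemma ex_bound:
  assumes "finite F" "F \<subseteq> univ S"
  shows "\<exists>y\<in>univ S. \<forall>x\<in>F. le x y"
proof (cases "F = {}")
  case True
  then show ?thesis using params(2) by blast
next
  case False
  then obtain m where "m \<in> F" "\<forall>x\<in>F. le x m" using ex_max[OF assms(1)] assms(2) by auto
  then show ?thesis using assms(2) by auto
qed

text \<open>Boundedness is first-order; through it, conditions that speak of finiteness become
  definable.\<close>

lemma finite_iff_bounded: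
  "finite {x \<in> univ S. X x} \<longleftrightarrow> (\<exists>y\<in>univ S. \<forall>x\<in>univ S. X x \<longrightarrow> le x y)"
proof
  assume "finite {x \<in> univ S. X x}"
  then show "\<exists>y\<in>univ S. \<forall>x\<in>univ S. X x \<longrightarrow> le x y"
    using ex_bound[of "{x \<in> univ S. X x}"] by auto
next
  assume "\<exists>y\<in>univ S. \<forall>x\<in>univ S. X x \<longrightarrow> le x y"
  then obtain y where y: "y \<in> univ S" "\<forall>x\<in>univ S. X x \<longrightarrow> le x y" by blast
  show "finite {x \<in> univ S. X x}"
    by (rule finite_subset[OF _ finite_initial[OF y(1)]]) (use y(2) in blast)
qed

text \<open>
  Otherwise the elements that increase almost all others would form a definable infinite set,
  disjoint from the set of their inverses.
\<close>

lemma finite_translate_not_equiv: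
  assumes H: "group H" "carrier H \<subseteq> univ S" "finite (univ S - carrier H)"
    and closed: "\<And>x y. x \<in> univ S \<Longrightarrow> y \<in> univ S \<Longrightarrow> x \<otimes>\<^bsub>H\<^esub> y \<in> univ S"
    and D_op: "D (\<lambda>w. w 0 = w 2 \<otimes>\<^bsub>H\<^esub> w 1)"
    and a: "a \<in> carrier H"
  shows "finite {x \<in> univ S. \<not> (le x (x \<otimes>\<^bsub>H\<^esub> a) \<and> le (x \<otimes>\<^bsub>H\<^esub> a) x)}"
proof -
  \<comment> \<open>\<open>H\<close> will be the additive group and the group of units. The latter
    omits 0, hence a carrier that is merely cofinite.\<close>
  interpret H: group H by fact
  note T_op' = T_op[where g = "mult H", OF closed D_op]
  \<comment> \<open>By totality, \<open>bad b\<close> is finite when translation by \<open>b\<close>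
    moves almost every element strictly up.\<close>
  define bad where "bad b = {x \<in> univ S. le (x \<otimes>\<^bsub>H\<^esub> b) x}" for b
  have shift: "finite {x \<in> carrier H. x \<otimes>\<^bsub>H\<^esub> b \<in> F}" if "finite F" "b \<in> carrier H" for b F
  proof -
    have "inj_on (\<lambda>x. x \<otimes>\<^bsub>H\<^esub> b) (carrier H)" using that by (intro inj_onI) simp
    then show ?thesis
      using finite_vimage_IntI[OF that(1), of "\<lambda>x. x \<otimes>\<^bsub>H\<^esub> b" "carrier H"]
      by (simp add: vimage_def Int_def conj_commute)
  qed
  have infH: "infinite (carrier H)"
    using infinite_univ H(2,3) by (metis finite_Diff2)
  \<comment> \<open>Otherwise some \<open>x\<close> would lie strictly below its translate by
    \<open>b\<close>, and that one strictly below its translate by the inverse, which is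
    \<open>x\<close> again.\<close>
  have no_inv: "infinite (bad (inv\<^bsub>H\<^esub> b))" if b: "b \<in> carrier H" "finite (bad b)" for b
  proof
    assume fin: "finite (bad (inv\<^bsub>H\<^esub> b))"
    have "finite (bad b \<union> {x \<in> carrier H. x \<otimes>\<^bsub>H\<^esub> b \<in> bad (inv\<^bsub>H\<^esub> b)})"
      using b(2) shift[OF fin b(1)] by simp
    then have "\<not> carrier H \<subseteq> bad b \<union> {x \<in> carrier H. x \<otimes>\<^bsub>H\<^esub> b \<in> bad (inv\<^bsub>H\<^esub> b)}"
      using infH finite_subset by metis
    then obtain x where x: "x \<in> carrier H" "x \<notin> bad b" "x \<otimes>\<^bsub>H\<^esub> b \<notin> bad (inv\<^bsub>H\<^esub> b)"
      by auto
    then have xb: "x \<otimes>\<^bsub>H\<^esub> b \<in> carrier H" using b by simp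
    have "x \<otimes>\<^bsub>H\<^esub> b \<otimes>\<^bsub>H\<^esub> inv\<^bsub>H\<^esub> b = x" using x(1) b(1) by (simp add: H.m_assoc)
    then show False
      using x xb total[of x "x \<otimes>\<^bsub>H\<^esub> b"] H(2) by (auto simp: bad_def)
  qed
  \<comment> \<open>Moving up by \<open>b\<close> and then by \<open>c\<close> moves up; the second
    move is good unless \<open>x\<close> lies in the preimage of \<open>bad c\<close>.\<close>
  have mult: "finite (bad (b \<otimes>\<^bsub>H\<^esub> c))"
    if bc: "b \<in> carrier H" "c \<in> carrier H" "finite (bad b)" "finite (bad c)" for b c
  proof (rule finite_subset)
    show "bad (b \<otimes>\<^bsub>H\<^esub> c) \<subseteq>
      (univ S - carrier H) \<union> (bad b \<union> {x \<in> carrier H. x \<otimes>\<^bsub>H\<^esub> b \<in> bad c})"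
    proof
      fix x assume x: "x \<in> bad (b \<otimes>\<^bsub>H\<^esub> c)"
      show "x \<in> (univ S - carrier H) \<union> (bad b \<union> {x \<in> carrier H. x \<otimes>\<^bsub>H\<^esub> b \<in> bad c})"
      proof (cases "x \<in> carrier H - bad b")
        case True
        then have U: "x \<in> univ S" "x \<otimes>\<^bsub>H\<^esub> b \<in> univ S" "x \<otimes>\<^bsub>H\<^esub> b \<otimes>\<^bsub>H\<^esub> c \<in> univ S"
          and assoc: "x \<otimes>\<^bsub>H\<^esub> (b \<otimes>\<^bsub>H\<^esub> c) = x \<otimes>\<^bsub>H\<^esub> b \<otimes>\<^bsub>H\<^esub> c"
          using bc H(2) closed by (auto simp: H.m_assoc)
        have "le x (x \<otimes>\<^bsub>H\<^esub> b)" using True U total by (auto simp: bad_def)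
        moreover have "le (x \<otimes>\<^bsub>H\<^esub> b \<otimes>\<^bsub>H\<^esub> c) x" using x assoc by (simp add: bad_def)
        ultimately have "le (x \<otimes>\<^bsub>H\<^esub> b \<otimes>\<^bsub>H\<^esub> c) (x \<otimes>\<^bsub>H\<^esub> b)" using trans U by simp
        then show ?thesis using True U by (simp add: bad_def)
      qed (use x in \<open>auto simp: bad_def\<close>)
    qed
  qed (use bc shift[of "bad c" b] H(3) in simp)
  have one: "infinite (bad \<one>\<^bsub>H\<^esub>)"
  proof (rule infinite_super[OF _ infH])
    show "carrier H \<subseteq> bad \<one>\<^bsub>H\<^esub>" using H(2) le_refl by (auto simp: bad_def)
  qed
  define P where "P = {b \<in> carrier H. finite (bad b)}"
  have "P = {}"
  proof (rule ccontr)
    assume "P \<noteq> {}"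
    then obtain b where b: "b \<in> P" by blast
    \<comment> \<open>Translation by \<open>b\<close> would permute a finite \<open>P\<close>, so
      \<open>b\<close> itself would be hit; cancelling puts the unit into \<open>P\<close>, although
      it moves nothing.\<close>
    have infP: "infinite P"
    proof
      assume fin: "finite P"
      have "inj_on (\<lambda>c. c \<otimes>\<^bsub>H\<^esub> b) P"
        using b by (auto simp: P_def inj_on_def)
      moreover have "(\<lambda>c. c \<otimes>\<^bsub>H\<^esub> b) ` P \<subseteq> P" using b mult by (auto simp: P_def)
      ultimately have "(\<lambda>c. c \<otimes>\<^bsub>H\<^esub> b) ` P = P" using fin endo_inj_surj by blast
      then obtain c where "c \<in> P" "c \<otimes>\<^bsub>H\<^esub> b = b" using b by (metis imageE)
      then have "\<one>\<^bsub>H\<^esub> \<in> P" using b H.r_cancel_one[of b c] by (auto simp: P_def)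
      then show False using one by (simp add: P_def)
    qed
    have "infinite {c \<in> univ S. finite (bad c)}"
      by (rule infinite_super[OF _ infP]) (use H(2) in \<open>auto simp: P_def\<close>)
    moreover have "D (\<lambda>w. finite (bad (w 0)))"
      unfolding bad_def finite_iff_bounded by (intro D_intros D_le T_op')
    ultimately have "finite {c \<in> univ S. \<not> finite (bad c)}"
      by (rule cofinite_of_infinite)
    \<comment> \<open>Inverses of elements of \<open>P\<close> lie in the finite complement of
      \<open>P\<close>, but there are infinitely many of them.\<close>
    then have "finite (m_inv H ` P)"
      by (rule finite_subset[rotated]) (use H(2) no_inv in \<open>auto simp: P_def\<close>)
    moreover have "inj_on (m_inv H) P"
      by (rule inj_on_subset[OF H.inv_inj]) (auto simp: P_def)
    ultimately show False using infP finite_imageD by blast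
  qed
  then have up: "finite {x \<in> univ S. \<not> le (x \<otimes>\<^bsub>H\<^esub> b) x}" if "b \<in> carrier H" for b
  proof -
    have "infinite {x \<in> univ S. le (x \<otimes>\<^bsub>H\<^esub> b) x}"
      using that \<open>P = {}\<close> by (auto simp: P_def bad_def)
    then show ?thesis
      by (rule cofinite_of_infinite)
         (use that H(2) in \<open>auto intro!: D_le T_op' T_var T_const\<close>)
  qed
  \<comment> \<open>One inequality is \<open>up\<close> for \<open>a\<close>. The other is
    \<open>up\<close> for the inverse of \<open>a\<close>, taken at the translate of
    \<open>x\<close>.\<close>
  have "{x \<in> univ S. \<not> (le x (x \<otimes>\<^bsub>H\<^esub> a) \<and> le (x \<otimes>\<^bsub>H\<^esub> a) x)} \<subseteq>
    (univ S - carrier H) \<union> ({x \<in> univ S. \<not> le (x \<otimes>\<^bsub>H\<^esub> a) x} \<union>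
     {x \<in> carrier H. x \<otimes>\<^bsub>H\<^esub> a \<in> {x \<in> univ S. \<not> le (x \<otimes>\<^bsub>H\<^esub> inv\<^bsub>H\<^esub> a) x}})"
    using a H(2) by (auto simp: H.m_assoc)
  then show ?thesis
    by (rule finite_subset) (use H(3) up[OF a] shift[OF up[of "inv\<^bsub>H\<^esub> a"] a] a in simp)
qed

text \<open>Asking for closure of all initial segments from \<open>x\<close> upwards makes the
  condition monotone in \<open>x\<close>, so \<open>x\<close> acts as a threshold for
  \<open>a\<close>.\<close>

definition stab :: "('a \<Rightarrow> 'a \<Rightarrow> 'a) \<Rightarrow> 'a \<Rightarrow> 'a \<Rightarrow> bool" where
  "stab g x a \<longleftrightarrow> (\<forall>y\<in>univ S. le x y \<longrightarrow> (\<forall>z\<in>univ S. le z y \<longrightarrow> le (g z a) y))"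

text \<open>Compares thresholds without choosing least ones. The initial segment of \<open>c\<close>
  is the intersection of the sets \<open>{a. stab g x a}\<close> over all thresholds
  \<open>x\<close> of \<open>c\<close>.\<close>

definition stab_le :: "('a \<Rightarrow> 'a \<Rightarrow> 'a) \<Rightarrow> 'a \<Rightarrow> 'a \<Rightarrow> bool" where
  "stab_le g a b \<longleftrightarrow> (\<forall>x\<in>univ S. stab g x b \<longrightarrow> stab g x a)"

lemma stab_mono:
  assumes "stab g x a" "le x y" "x \<in> univ S" "y \<in> univ S" shows "stab g y a"
  unfolding stab_def
proof (intro ballI impI)
  fix u z assume "u \<in> univ S" "le y u" "z \<in> univ S" "le z u"
  then show "le (g z a) u"
    using assms trans[of x y u] unfolding stab_def by simp
qed

text \<open>Only finitely many \<open>z\<close> are moved up by \<open>a\<close>; any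
  \<open>x\<close> above their images is a threshold.\<close>

lemma ex_stab:
  assumes closed: "\<And>x y. x \<in> univ S \<Longrightarrow> y \<in> univ S \<Longrightarrow> g x y \<in> univ S"
    and a: "a \<in> univ S" and fin: "finite {z \<in> univ S. \<not> le (g z a) z}"
  shows "\<exists>x\<in>univ S. stab g x a"
proof -
  let ?F = "{z \<in> univ S. \<not> le (g z a) z}"
  obtain x where x: "x \<in> univ S" "\<forall>z\<in>?F. le (g z a) x"
    using ex_bound[of "(\<lambda>z. g z a) ` ?F"] fin closed a by auto
  have "le (g z a) y" if "y \<in> univ S" "le x y" "z \<in> univ S" "le z y" for y z
  proof (cases "z \<in> ?F")
    case True
    then have "le (g z a) x" using x(2) by blast
    then show ?thesis using that x(1) closed a trans[of "g z a" x y] by simp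
  next
    case False
    then show ?thesis using that closed a trans[of "g z a" z y] by simp
  qed
  then show ?thesis using x(1) unfolding stab_def by blast
qed

text \<open>Threshold sets are upward closed, hence comparable by inclusion, which gives totality.
  For finiteness, take \<open>y\<close> above a threshold of \<open>a\<close> with
  \<open>g y\<close> injective: every \<open>b\<close> below \<open>a\<close> satisfies
  \<open>le (g y b) y\<close>, so \<open>g y\<close> embeds the initial segment of \<open>a\<close>
  into that of \<open>y\<close>.\<close>

lemma omega_preorder_stab_le:
  assumes closed: "\<And>x y. x \<in> univ S \<Longrightarrow> y \<in> univ S \<Longrightarrow> g x y \<in> univ S"
    and D_g: "D (\<lambda>w. w 0 = g (w 2) (w 1))"
    and ex: "\<And>a. a \<in> univ S \<Longrightarrow> \<exists>x\<in>univ S. stab g x a"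
    and inj: "finite Z" "\<And>y. y \<in> univ S \<Longrightarrow> y \<notin> Z \<Longrightarrow> inj_on (g y) (univ S)"
  shows "omega_preorder L S R (stab_le g)"
proof unfold_locales
  show "D (\<lambda>w. stab_le g (w 1) (w 0))"
    unfolding stab_le_def stab_def
    by (intro D_intros D_le T_op[where g = g, OF closed D_g])
next
  fix a assume a: "a \<in> univ S"
  obtain x where x: "x \<in> univ S" "stab g x a" using ex[OF a] by blast
  obtain y where y: "y \<in> univ S" "y \<notin> Z \<union> {y \<in> univ S. le y x}"
    using ex_notin[of "Z \<union> {y \<in> univ S. le y x}"] inj(1) finite_initial[OF x(1)] by auto
  then have "le x y" using total[OF x(1) y(1)] by auto
  have "g y ` {b \<in> univ S. stab_le g b a} \<subseteq> {z \<in> univ S. le z y}"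
  proof (rule image_subsetI)
    fix b assume b: "b \<in> {b \<in> univ S. stab_le g b a}"
    then have "stab g x b" using x by (auto simp: stab_le_def)
    then have "le (g y b) y" using y(1) \<open>le x y\<close> le_refl by (simp add: stab_def)
    then show "g y b \<in> {z \<in> univ S. le z y}" using b y(1) closed by simp
  qed
  then have "finite (g y ` {b \<in> univ S. stab_le g b a})"
    using finite_initial[OF y(1)] by (rule finite_subset)
  moreover have "inj_on (g y) {b \<in> univ S. stab_le g b a}"
    by (rule inj_on_subset[OF inj(2)]) (use y in auto)
  ultimately show "finite {b \<in> univ S. stab_le g b a}" by (rule finite_imageD)
next
  fix a b assume "a \<in> univ S" "b \<in> univ S"
  show "stab_le g a b \<or> stab_le g b a"
  proof (rule disjCI)
    assume "\<not> stab_le g b a"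
    then obtain x where x: "x \<in> univ S" "stab g x a" "\<not> stab g x b"
      unfolding stab_le_def by blast
    show "stab_le g a b"
      unfolding stab_le_def
    proof (intro ballI impI)
      fix y assume y: "y \<in> univ S" "stab g y b"
      then have "\<not> le y x" using x stab_mono[of g y b x] by auto
      then have "le x y" using total[OF x(1) y(1)] by auto
      then show "stab g y a" using x y stab_mono[of g x a y] by auto
    qed
  qed
next
  fix a b c assume "stab_le g a b" "stab_le g b c"
  then show "stab_le g a c" unfolding stab_le_def by blast
qed

text \<open>By associativity a product acts as its factors in succession, and each factor preserves
  the same initial segments.\<close>

lemma stab_le_mult:
  assumes closed: "\<And>x y. x \<in> univ S \<Longrightarrow> y \<in> univ S \<Longrightarrow> g x y \<in> univ S"
    and assoc: "\<And>x y z. x \<in> univ S \<Longrightarrow> y \<in> univ S \<Longrightarrow> z \<in> univ S \<Longrightarrow> g x (g y z) = g (g x y) z"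
    and "a \<in> univ S" "b \<in> univ S" "stab_le g a c" "stab_le g b c"
  shows "stab_le g (g a b) c"
  unfolding stab_le_def
proof (intro ballI impI)
  fix x assume x: "x \<in> univ S" "stab g x c"
  then have "stab g x a" "stab g x b" using assms(5,6) by (simp_all add: stab_le_def)
  then have "le (g z (g a b)) y" if "y \<in> univ S" "le x y" "z \<in> univ S" "le z y" for y z
    using that assms(3,4) by (simp add: assoc closed stab_def)
  then show "stab g x (g a b)" by (simp add: stab_def)
qed

lemma inj_on_add: "x \<in> univ S \<Longrightarrow> inj_on ((\<oplus>) x) (univ S)"
  using group.inj_on_cmult[OF a_group, of x] by (simp add: carrier_eq)

lemma inj_on_mult: "x \<in> univ S \<Longrightarrow> x \<noteq> \<zero> \<Longrightarrow> inj_on ((\<otimes>) x) (univ S)"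
  by (intro inj_onI) (simp add: m_lcancel flip: carrier_eq)

lemma ex_add_closed:
  "\<exists>le'. omega_preorder L S R le' \<and>
     (\<forall>a\<in>univ S. \<forall>b\<in>univ S. \<forall>c\<in>univ S. le' a c \<longrightarrow> le' b c \<longrightarrow> le' (a \<oplus> b) c)"
proof (intro exI conjI ballI impI)
  have closed: "x \<oplus> y \<in> univ S" if "x \<in> univ S" "y \<in> univ S" for x y
    using that by (simp flip: carrier_eq)
  show "omega_preorder L S R (stab_le (\<oplus>))"
  proof (rule omega_preorder_stab_le[OF _ D_add, of "{}"])
    fix a assume a: "a \<in> univ S"
    have "finite {x \<in> univ S. \<not> (le x (x \<oplus> a) \<and> le (x \<oplus> a) x)}"
      using finite_translate_not_equiv[of "add_monoid R" a] a a_group closed D_add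
      by (simp add: carrier_eq)
    then have "finite {x \<in> univ S. \<not> le (x \<oplus> a) x}"
      by (rule finite_subset[rotated]) blast
    then show "\<exists>x\<in>univ S. stab (\<oplus>) x a" using a closed by (intro ex_stab)
  next
    fix y assume "y \<in> univ S"
    then show "inj_on ((\<oplus>) y) (univ S)" by (rule inj_on_add)
  qed (use closed in auto)
  fix a b c assume "a \<in> univ S" "b \<in> univ S" "c \<in> univ S" "stab_le (\<oplus>) a c" "stab_le (\<oplus>) b c"
  then show "stab_le (\<oplus>) (a \<oplus> b) c"
    by (intro stab_le_mult) (auto simp: a_assoc simp flip: carrier_eq)
qed

text \<open>Closure under addition survives since \<open>z \<otimes> (a \<oplus> b)\<close> is the
  sum of \<open>z \<otimes> a\<close> and \<open>z \<otimes> b\<close>, both in an initial segment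
  closed under addition.\<close>

lemma ex_mult_closed:
  assumes add: "\<And>a b c. a \<in> univ S \<Longrightarrow> b \<in> univ S \<Longrightarrow> c \<in> univ S \<Longrightarrow> le a c \<Longrightarrow> le b c \<Longrightarrow> le (a \<oplus> b) c"
  shows "\<exists>le'. omega_preorder L S R le' \<and>
     (\<forall>a\<in>univ S. \<forall>b\<in>univ S. \<forall>c\<in>univ S. le' a c \<longrightarrow> le' b c \<longrightarrow> le' (a \<oplus> b) c \<and> le' (a \<otimes> b) c)"
proof (intro exI conjI ballI impI)
  have closed: "x \<otimes> y \<in> univ S" if "x \<in> univ S" "y \<in> univ S" for x y
    using that by (simp flip: carrier_eq)
  have units: "Units R = univ S - {\<zero>}" using field_Units by (simp add: carrier_eq)
  show "omega_preorder L S R (stab_le (\<otimes>))"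
  proof (rule omega_preorder_stab_le[OF _ D_mult, of "{\<zero>}"])
    fix a assume a: "a \<in> univ S"
    show "\<exists>x\<in>univ S. stab (\<otimes>) x a"
    proof (cases "a = \<zero>")
      case True
      \<comment> \<open>The non-unit 0 maps everything to 0, so it stabilizes each initial segment
        that contains 0.\<close>
      have "stab (\<otimes>) \<zero> a" using True by (auto simp: stab_def simp flip: carrier_eq)
      then show ?thesis using a True by blast
    next
      case False
      have "finite (univ S - (univ S - {\<zero>}))" by (rule finite_subset[of _ "{\<zero>}"]) auto
      then have "finite {x \<in> univ S. \<not> (le x (x \<otimes> a) \<and> le (x \<otimes> a) x)}"
        using finite_translate_not_equiv[of "units_of R" a] a False units_group closed D_mult
        by (simp add: units_of_def units)
      then have "finite {x \<in> univ S. \<not> le (x \<otimes> a) x}"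
        by (rule finite_subset[rotated]) blast
      then show ?thesis using a closed by (intro ex_stab)
    qed
  next
    fix y assume "y \<in> univ S" "y \<notin> {\<zero>}"
    then show "inj_on ((\<otimes>) y) (univ S)" by (intro inj_on_mult) auto
  qed (use closed in auto)
  fix a b c assume abc: "a \<in> univ S" "b \<in> univ S" "c \<in> univ S" "stab_le (\<otimes>) a c" "stab_le (\<otimes>) b c"
  then show "stab_le (\<otimes>) (a \<otimes> b) c"
    by (intro stab_le_mult) (auto simp: m_assoc simp flip: carrier_eq)
  show "stab_le (\<otimes>) (a \<oplus> b) c"
    unfolding stab_le_def
  proof (intro ballI impI)
    fix x assume x: "x \<in> univ S" "stab (\<otimes>) x c"
    then have "stab (\<otimes>) x a" "stab (\<otimes>) x b" using abc by (simp_all add: stab_le_def)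
    then have "le (z \<otimes> (a \<oplus> b)) y" if "y \<in> univ S" "le x y" "z \<in> univ S" "le z y" for y z
      using that abc add[of "z \<otimes> a" "z \<otimes> b" y] closed
      by (simp add: stab_def r_distr[unfolded carrier_eq])
    then show "stab (\<otimes>) x (a \<oplus> b)" by (simp add: stab_def)
  qed
qed

text \<open>
  If initial segments are subfields, then \<open>sq y\<close> lies strictly below \<open>y\<close> for almost every \<open>y\<close>. But
  \<open>y\<close> can be recovered from \<open>sq y\<close>, \<open>sq (c y)\<close> and a small constant \<open>c\<close>.
\<close>

lemma no_subfield_filtration:
  assumes add: "\<And>a b c. a \<in> univ S \<Longrightarrow> b \<in> univ S \<Longrightarrow> c \<in> univ S \<Longrightarrow> le a c \<Longrightarrow> le b c \<Longrightarrow> le (a \<oplus> b) c"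
    and mult: "\<And>a b c. a \<in> univ S \<Longrightarrow> b \<in> univ S \<Longrightarrow> c \<in> univ S \<Longrightarrow> le a c \<Longrightarrow> le b c \<Longrightarrow> le (a \<otimes> b) c"
  shows False
proof -
  \<comment> \<open>An injective self-map of a finite initial segment is onto, so \<open>g y\<close>
    in the segment forces \<open>y\<close> into it. This replaces subtraction and division.\<close>
  have cancel: "le y m"
    if inj: "inj_on g (univ S)" and g: "\<And>z. z \<in> univ S \<Longrightarrow> le z m \<Longrightarrow> g z \<in> univ S \<and> le (g z) m"
      and y: "y \<in> univ S" "g y \<in> univ S" "le (g y) m" and m: "m \<in> univ S" for g y m
  proof -
    let ?B = "{z \<in> univ S. le z m}"
    have gB: "g ` ?B \<subseteq> ?B" using g by blast
    have "inj_on g ?B" by (rule inj_on_subset[OF inj]) blast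
    then have surj: "g ` ?B = ?B" by (rule endo_inj_surj[OF finite_initial[OF m] gB])
    have "g y \<in> g ` ?B" using surj y by blast
    then obtain z where "z \<in> univ S" "le z m" "g y = g z" by blast
    then show ?thesis using inj y by (auto dest: inj_onD)
  qed
  have sq_le: "le (sq y) y" if "y \<in> univ S" for y
    unfolding sq_def using that add mult le_refl by (simp flip: carrier_eq)
  let ?Bad = "{y \<in> univ S. le y (sq y)}"
  have Bad: "finite ?Bad"
    by (rule finite_subset[OF _ finite_sq_equiv]) (use sq_le in blast)
  obtain c where c: "c \<in> univ S" "c \<notin> {\<zero>, \<one>}" using ex_notin[of "{\<zero>, \<one>}"] by auto
  \<comment> \<open>Chosen to eliminate the square: \<open>e \<otimes> sq y\<close> and
    \<open>sq (c \<otimes> y)\<close> differ by \<open>d \<otimes> y\<close>. Excluding 0 and 1 for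
    \<open>c\<close> makes \<open>d\<close> nonzero.\<close>
  define e d where "e = c \<otimes> c" and "d = c \<otimes> c \<ominus> c"
  have cR: "c \<in> carrier R" "c \<noteq> \<zero>" "c \<noteq> \<one>" using c by (simp_all add: carrier_eq)
  have deU: "d \<in> univ S" "e \<in> univ S" using cR by (simp_all add: e_def d_def flip: carrier_eq)
  have "d = c \<otimes> (c \<ominus> \<one>)" using cR unfolding d_def by algebra
  moreover have "c \<ominus> \<one> \<noteq> \<zero>" using cR eq_of_minus_zero[of c \<one>] by auto
  ultimately have d0: "d \<noteq> \<zero>" using cR by (simp add: integral_iff)
  have "finite {y \<in> univ S. c \<otimes> y \<in> ?Bad}"
    using finite_vimage_IntI[OF Bad inj_on_mult[of c]] c
    by (simp add: vimage_def Int_def conj_commute)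
  then obtain y where y: "y \<in> univ S"
    "y \<notin> ?Bad \<union> ({y \<in> univ S. c \<otimes> y \<in> ?Bad} \<union> ({x \<in> univ S. le x c} \<union>
       ({x \<in> univ S. le x d} \<union> {x \<in> univ S. le x e})))"
    using ex_notin[of "?Bad \<union> ({y \<in> univ S. c \<otimes> y \<in> ?Bad} \<union> ({x \<in> univ S. le x c} \<union>
       ({x \<in> univ S. le x d} \<union> {x \<in> univ S. le x e})))"]
      Bad finite_initial c(1) deU by auto
  have yR: "y \<in> carrier R" using y(1) by (simp add: carrier_eq)
  have cyU: "c \<otimes> y \<in> univ S" using cR yR by (simp flip: carrier_eq)
  have cy: "le (c \<otimes> y) y" using c(1) y le_refl total[of c y] by (intro mult) auto
  \<comment> \<open>All ingredients of the recovery lie in the initial segment of \<open>m\<close>.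
    As \<open>m\<close> is one of them, it lies strictly below \<open>y\<close>.\<close>
  obtain m where m: "m \<in> {d, e, sq y, sq (c \<otimes> y)}"
    "\<forall>x\<in>{d, e, sq y, sq (c \<otimes> y)}. le x m"
    using ex_max[of "{d, e, sq y, sq (c \<otimes> y)}"] deU sq_closed[OF y(1)] sq_closed[OF cyU] by auto
  have mU: "m \<in> univ S" using m(1) deU sq_closed[OF y(1)] sq_closed[OF cyU] by auto
  have "\<not> le y m"
  proof
    assume ym: "le y m"
    \<comment> \<open>Otherwise \<open>c \<otimes> y\<close>, which lies below \<open>y\<close>,
      would lie below its own image under \<open>sq\<close> and be in \<open>?Bad\<close>.\<close>
    have "\<not> le y (sq (c \<otimes> y))"
      using trans[OF cy, of "sq (c \<otimes> y)"] y cyU sq_closed[OF cyU] by auto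
    then show False using ym m(1) y by auto
  qed
  have "sq (c \<otimes> y) \<oplus> d \<otimes> y = e \<otimes> sq y" using cR yR unfolding sq_def d_def e_def by algebra
  moreover have "le (e \<otimes> sq y) m"
    using m(2) mU deU sq_closed[OF y(1)] mult[of e "sq y" m] by simp
  ultimately have "le (sq (c \<otimes> y) \<oplus> d \<otimes> y) m" by simp
  have dyU: "d \<otimes> y \<in> univ S" using deU y(1) by (simp flip: carrier_eq)
  have "le (d \<otimes> y) m"
  proof (rule cancel[where g = "\<lambda>z. sq (c \<otimes> y) \<oplus> z"])
    show "inj_on (\<lambda>z. sq (c \<otimes> y) \<oplus> z) (univ S)" using inj_on_add[OF sq_closed[OF cyU]] .
    show "sq (c \<otimes> y) \<oplus> z \<in> univ S \<and> le (sq (c \<otimes> y) \<oplus> z) m" if "z \<in> univ S" "le z m" for z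
      using that add[of "sq (c \<otimes> y)" z m] m(2) mU sq_closed[OF cyU] by (simp flip: carrier_eq)
    show "sq (c \<otimes> y) \<oplus> d \<otimes> y \<in> univ S"
      using dyU sq_closed[OF cyU] by (simp flip: carrier_eq)
  qed (fact dyU mU \<open>le (sq (c \<otimes> y) \<oplus> d \<otimes> y) m\<close>)+
  then have "le y m"
  proof (rule cancel[where g = "(\<otimes>) d", OF inj_on_mult[OF deU(1) d0], rotated 3])
    show "d \<otimes> z \<in> univ S \<and> le (d \<otimes> z) m" if "z \<in> univ S" "le z m" for z
      using that mult[of d z m] m(2) mU deU by (simp flip: carrier_eq)
  qed (use mU y(1) dyU in auto)
  then show False using \<open>\<not> le y m\<close> by simp
qed

end

context def_preorder
begin

lemma no_def_preorder: False
proof -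
  obtain le1 where le1: "omega_preorder L S R le1" using ex_omega_preorder by (elim exE)
  obtain le2 where le2: "omega_preorder L S R le2"
    "\<forall>a\<in>univ S. \<forall>b\<in>univ S. \<forall>c\<in>univ S. le2 a c \<longrightarrow> le2 b c \<longrightarrow> le2 (a \<oplus> b) c"
    using omega_preorder.ex_add_closed[OF le1] by (elim exE conjE)
  have "\<exists>le'. omega_preorder L S R le' \<and>
     (\<forall>a\<in>univ S. \<forall>b\<in>univ S. \<forall>c\<in>univ S. le' a c \<longrightarrow> le' b c \<longrightarrow> le' (a \<oplus> b) c \<and> le' (a \<otimes> b) c)"
    by (rule omega_preorder.ex_mult_closed[OF le2(1)]) (use le2(2) in auto)
  then obtain le3 where le3: "omega_preorder L S R le3"
    "\<forall>a\<in>univ S. \<forall>b\<in>univ S. \<forall>c\<in>univ S. le3 a c \<longrightarrow> le3 b c \<longrightarrow> le3 (a \<oplus> b) c \<and> le3 (a \<otimes> b) c"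
    by (elim exE conjE)
  show False
    by (rule omega_preorder.no_subfield_filtration[OF le3(1)]) (use le3(2) in auto)
qed

end

section \<open>The generic type and saturation\<close>

lemma sat1_Neg: "sat1 S (Neg \<phi>, s) a \<longleftrightarrow> \<not> sat1 S (\<phi>, s) a"
  by simp

lemma pformulas_Neg: "(\<phi>, s) \<in> pformulas L n A \<Longrightarrow> (Neg \<phi>, s) \<in> pformulas L n A"
  by (auto simp: pformulas_def formulas_def)

lemma pformulas_mono: "A \<subseteq> B \<Longrightarrow> pformulas L n A \<subseteq> pformulas L n B"
  by (auto simp: pformulas_def)

lemma minimalD:
  assumes "minimal L M" "\<theta> \<in> pformulas L 1 (univ M)"
  shows "finite {a \<in> univ M. sat1 M \<theta> a} \<or> finite {a \<in> univ M. \<not> sat1 M \<theta> a}"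
proof -
  have "definable L M {a \<in> univ M. sat1 M \<theta> a}" using assms(2) by (auto simp: definable_def)
  moreover have "univ M - {a \<in> univ M. sat1 M \<theta> a} = {a \<in> univ M. \<not> sat1 M \<theta> a}" by blast
  ultimately show ?thesis using assms(1) unfolding minimal_def by metis
qed

text \<open>By minimality a formula or its negation has a finite solution set, so a non-algebraic
  type can contain only the cofinite ones, and completeness forces all of them in.\<close>

lemma generic_type_eq:
  assumes "minimal L M"
  shows "generic_type L M = {\<theta> \<in> pformulas L 1 (univ M). finite {a \<in> univ M. \<not> sat1 M \<theta> a}}"
    (is "_ = ?p")
  unfolding generic_type_def
proof (rule the_equality)
  have inf: "infinite (univ M)" using assms by (simp add: minimal_def)
  have not_both: "infinite {a \<in> univ M. sat1 M \<theta> a}" if "finite {a \<in> univ M. \<not> sat1 M \<theta> a}" for \<theta>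
  proof
    assume "finite {a \<in> univ M. sat1 M \<theta> a}"
    then have "finite ({a \<in> univ M. sat1 M \<theta> a} \<union> {a \<in> univ M. \<not> sat1 M \<theta> a})"
      using that by simp
    moreover have "{a \<in> univ M. sat1 M \<theta> a} \<union> {a \<in> univ M. \<not> sat1 M \<theta> a} = univ M" by blast
    ultimately show False using inf by simp
  qed
  have "?p \<in> types1 L M (univ M)"
    unfolding types1_def
  proof (intro CollectI conjI allI impI ballI)
    fix F assume F: "F \<subseteq> ?p" "finite F"
    have "finite (\<Union>\<theta>\<in>F. {a \<in> univ M. \<not> sat1 M \<theta> a})"
      using F by (intro finite_UN_I) auto
    then have "\<not> univ M \<subseteq> (\<Union>\<theta>\<in>F. {a \<in> univ M. \<not> sat1 M \<theta> a})"
      using inf finite_subset[of "univ M"] by auto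
    then show "\<exists>a\<in>univ M. \<forall>\<theta>\<in>F. sat1 M \<theta> a" by blast
  next
    fix \<theta> assume \<theta>: "\<theta> \<in> pformulas L 1 (univ M)"
    obtain \<phi> s where [simp]: "\<theta> = (\<phi>, s)" by (cases \<theta>)
    show "case \<theta> of (\<phi>, s) \<Rightarrow> (\<phi>, s) \<in> ?p \<or> (Neg \<phi>, s) \<in> ?p"
      using minimalD[OF assms \<theta>] \<theta> pformulas_Neg[of \<phi> s] by (auto simp: sat1_Neg simp del: sat1.simps)
  qed blast
  moreover have "\<not> algebraic_type M ?p" using not_both by (auto simp: algebraic_type_def)
  ultimately show "?p \<in> types1 L M (univ M) \<and> \<not> algebraic_type M ?p" by blast
  fix q assume "q \<in> types1 L M (univ M) \<and> \<not> algebraic_type M q"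
  then have q: "q \<subseteq> pformulas L 1 (univ M)"
    "\<And>\<phi> s. (\<phi>, s) \<in> pformulas L 1 (univ M) \<Longrightarrow> (\<phi>, s) \<in> q \<or> (Neg \<phi>, s) \<in> q"
    "\<And>\<theta>. \<theta> \<in> q \<Longrightarrow> infinite {a \<in> univ M. sat1 M \<theta> a}"
    by (auto simp: types1_def algebraic_type_def simp del: sat1.simps)
  show "q = ?p"
  proof
    show "q \<subseteq> ?p" using q(1,3) minimalD[OF assms] by blast
    show "?p \<subseteq> q"
    proof
      fix \<theta> assume \<theta>: "\<theta> \<in> ?p"
      obtain \<phi> s where [simp]: "\<theta> = (\<phi>, s)" by (cases \<theta>)
      have "(Neg \<phi>, s) \<notin> q" using q(3)[of "(Neg \<phi>, s)"] \<theta> by (auto simp: sat1_Neg)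
      then show "\<theta> \<in> q" using q(2)[of \<phi> s] \<theta> by auto
    qed
  qed
qed

text \<open>The equivalence is uniform in the structure, so that one formula serves in both
  \<open>M\<close> and \<open>N\<close>.\<close>

lemma pformulas_remove:
  fixes L :: "('f, 'r) language" and A :: "'a set"
  assumes "(\<phi>, s) \<in> pformulas L 1 A" "e \<in> A"
  shows "\<exists>\<phi>' s'. (\<phi>', s') \<in> pformulas L 1 A \<and>
    (\<forall>(S :: ('f, 'r, 'a) struct) a. sat1 S (\<phi>', s') a \<longleftrightarrow> sat1 S (\<phi>, s) a \<and> a \<noteq> e)"
proof -
  obtain j where j: "j \<notin> insert 0 (fv \<phi>)"
    using ex_new_if_finite[OF infinite_UNIV_nat, of "insert 0 (fv \<phi>)"] finite_fv by blast
  let ?\<phi> = "Conj \<phi> (Neg (Eq (Var 0) (Var j)))" and ?s = "s(j := e)"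
  have "(?\<phi>, ?s) \<in> pformulas L 1 A"
    using assms j by (auto simp: pformulas_def formulas_def)
  moreover have "sat1 S (?\<phi>, ?s) a \<longleftrightarrow> sat1 S (\<phi>, s) a \<and> a \<noteq> e"
    for S :: "('f, 'r, 'a) struct" and a
  proof -
    have "sat S ((s(j := e))(0 := a)) \<phi> \<longleftrightarrow> sat S (s(0 := a)) \<phi>"
      using j by (intro sat_cong) auto
    then show ?thesis using j by simp
  qed
  ultimately show ?thesis by blast
qed

lemma pformulas_remove_finite:
  fixes L :: "('f, 'r) language" and A :: "'a set"
  assumes "finite E" "E \<subseteq> A" "(\<phi>, s) \<in> pformulas L 1 A"
  shows "\<exists>\<phi>' s'. (\<phi>', s') \<in> pformulas L 1 A \<and>
    (\<forall>(S :: ('f, 'r, 'a) struct) a. sat1 S (\<phi>', s') a \<longleftrightarrow> sat1 S (\<phi>, s) a \<and> a \<notin> E)"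
  using assms(1,2)
proof (induction E)
  case empty
  show ?case using assms(3) by auto
next
  case (insert e E)
  then obtain \<phi>1 s1 where 1: "(\<phi>1, s1) \<in> pformulas L 1 A"
    "\<forall>(S :: ('f, 'r, 'a) struct) a. sat1 S (\<phi>1, s1) a \<longleftrightarrow> sat1 S (\<phi>, s) a \<and> a \<notin> E"
    by auto
  have "e \<in> A" using insert.prems by simp
  from pformulas_remove[OF 1(1) this] obtain \<phi>2 s2 where 2: "(\<phi>2, s2) \<in> pformulas L 1 A"
    "\<forall>(S :: ('f, 'r, 'a) struct) a. sat1 S (\<phi>2, s2) a \<longleftrightarrow> sat1 S (\<phi>1, s1) a \<and> a \<noteq> e"
    by (elim exE conjE)
  have "\<forall>(S :: ('f, 'r, 'a) struct) a. sat1 S (\<phi>2, s2) a \<longleftrightarrow> sat1 S (\<phi>, s) a \<and> a \<notin> insert e E"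
    by (simp only: 2(2) 1(2) insert_iff de_Morgan_disj conj_ac simp_thms)
  then show ?case using 2(1) by (intro exI conjI)
qed

section \<open>Realizing the generic type outside the small model\<close>

lemma elementary_extension_empty:
  assumes "elementary_extension L M N" "(\<phi>, s) \<in> pformulas L 1 (univ M)"
    and "\<And>a. a \<in> univ M \<Longrightarrow> \<not> sat1 M (\<phi>, s) a" "a \<in> univ N"
  shows "\<not> sat1 N (\<phi>, s) a"
proof -
  have "Ex 0 \<phi> \<in> formulas L" using assms(2) by (simp add: pformulas_def formulas_def)
  moreover have "\<forall>x\<in>fv (Ex 0 \<phi>). s x \<in> univ M"
    using assms(2) by (auto simp: pformulas_def Suc_le_eq)
  ultimately have "sat M s (Ex 0 \<phi>) \<longleftrightarrow> sat N s (Ex 0 \<phi>)"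
    using assms(1) unfolding elementary_extension_def by blast
  then show ?thesis using assms(3,4) by auto
qed

text \<open>The finitely many exceptions to a generic formula are named by parameters. That there
  are no others is a first-order statement, so the extension adds none.\<close>

lemma generic_realizations:
  fixes L :: "('f, 'r) language" and M N :: "('f, 'r, 'a) struct"
  assumes "minimal L M" "elementary_extension L M N"
  shows "univ N - univ M \<subseteq> realizations N (generic_type L M)"
proof
  fix x assume x: "x \<in> univ N - univ M"
  have "sat1 N \<theta> x" if \<theta>: "\<theta> \<in> pformulas L 1 (univ M)"
    and fin: "finite {a \<in> univ M. \<not> sat1 M \<theta> a}" for \<theta>
  proof -
    obtain \<phi> s where \<theta>_eq: "\<theta> = (\<phi>, s)" by (cases \<theta>)
    let ?E = "{a \<in> univ M. \<not> sat1 M \<theta> a}"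
    have "(Neg \<phi>, s) \<in> pformulas L 1 (univ M)" using pformulas_Neg \<theta> \<theta>_eq by blast
    from pformulas_remove_finite[OF fin _ this]
    obtain \<phi>' s' where 1: "(\<phi>', s') \<in> pformulas L 1 (univ M)"
      "\<forall>(S :: ('f, 'r, 'a) struct) a. sat1 S (\<phi>', s') a \<longleftrightarrow> sat1 S (Neg \<phi>, s) a \<and> a \<notin> ?E"
      by auto
    have "\<not> sat1 N (\<phi>', s') x"
    proof (rule elementary_extension_empty[OF assms(2) 1(1)])
      show "\<not> sat1 M (\<phi>', s') a" if "a \<in> univ M" for a
        using that by (simp only: 1(2) sat1_Neg \<theta>_eq) blast
    qed (use x in blast)
    then have "\<not> (\<not> sat1 N (\<phi>, s) x \<and> x \<notin> ?E)" by (simp only: 1(2) sat1_Neg not_False_eq_True)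
    moreover have "x \<notin> ?E" using x by blast
    ultimately show ?thesis unfolding \<theta>_eq by blast
  qed
  then show "x \<in> realizations N (generic_type L M)"
    using x unfolding realizations_def generic_type_eq[OF assms(1)] by blast
qed

section \<open>Compactness from saturation\<close>

lemma ex_type_extending:
  assumes sub: "\<Gamma> \<subseteq> pformulas L 1 A"
    and fin: "\<And>F. F \<subseteq> \<Gamma> \<Longrightarrow> finite F \<Longrightarrow> \<exists>a\<in>univ N. \<forall>\<theta>\<in>F. sat1 N \<theta> a"
  shows "\<exists>p \<in> types1 L N A. \<Gamma> \<subseteq> p"
proof -
  \<comment> \<open>Saturation concerns complete types, so a maximal finitely satisfiable set is
    taken; maximality decides every formula.\<close>
  define fs where "fs p \<longleftrightarrow> (\<forall>F\<subseteq>p. finite F \<longrightarrow> (\<exists>a\<in>univ N. \<forall>\<theta>\<in>F. sat1 N \<theta> a))" for p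
  let ?P = "{p. \<Gamma> \<subseteq> p \<and> p \<subseteq> pformulas L 1 A \<and> fs p}"
  have "\<exists>p\<in>?P. \<forall>q\<in>?P. p \<subseteq> q \<longrightarrow> q = p"
  proof (rule subset_Zorn_nonempty)
    have "\<Gamma> \<in> ?P" using sub fin by (simp add: fs_def)
    then show "?P \<noteq> {}" by blast
    fix C assume C: "C \<noteq> {}" "subset.chain ?P C"
    have "fs (\<Union>C)"
      unfolding fs_def
    proof (intro allI impI)
      fix F assume "F \<subseteq> \<Union>C" "finite F"
      then obtain p where "p \<in> C" "F \<subseteq> p"
        using finite_subset_Union_chain[OF _ _ C] by metis
      moreover have "fs p" using C(2) \<open>p \<in> C\<close> by (auto simp: subset.chain_def)
      ultimately show "\<exists>a\<in>univ N. \<forall>\<theta>\<in>F. sat1 N \<theta> a" using \<open>finite F\<close> by (simp add: fs_def)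
    qed
    moreover have sub: "\<Gamma> \<subseteq> p" "p \<subseteq> pformulas L 1 A" if "p \<in> C" for p
      using C(2) that unfolding subset.chain_def by blast+
    then have "\<Gamma> \<subseteq> \<Union>C" "\<Union>C \<subseteq> pformulas L 1 A" using C(1) by blast+
    ultimately show "\<Union>C \<in> ?P" by simp
  qed
  then obtain p where p: "\<Gamma> \<subseteq> p" "p \<subseteq> pformulas L 1 A" "fs p"
    and max: "\<And>q. \<Gamma> \<subseteq> q \<Longrightarrow> q \<subseteq> pformulas L 1 A \<Longrightarrow> fs q \<Longrightarrow> p \<subseteq> q \<Longrightarrow> q = p"
    by auto
  have ex: "\<exists>F\<subseteq>p. finite F \<and> \<not> (\<exists>a\<in>univ N. sat1 N \<theta> a \<and> (\<forall>\<theta>'\<in>F. sat1 N \<theta>' a))"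
    if \<theta>: "\<theta> \<in> pformulas L 1 A" "\<theta> \<notin> p" for \<theta>
  proof -
    have "\<not> fs (insert \<theta> p)"
    proof
      assume "fs (insert \<theta> p)"
      then have "insert \<theta> p = p" using p(1,2) \<theta>(1) by (intro max) auto
      then show False using \<theta>(2) by blast
    qed
    then obtain F where F: "F \<subseteq> insert \<theta> p" "finite F" "\<not> (\<exists>a\<in>univ N. \<forall>\<theta>\<in>F. sat1 N \<theta> a)"
      unfolding fs_def by blast
    then have "F - {\<theta>} \<subseteq> p" "finite (F - {\<theta>})"
      "\<not> (\<exists>a\<in>univ N. sat1 N \<theta> a \<and> (\<forall>\<theta>'\<in>F - {\<theta>}. sat1 N \<theta>' a))" by auto
    then show ?thesis by blast
  qed
  have "(\<phi>, s) \<in> p \<or> (Neg \<phi>, s) \<in> p" if \<phi>: "(\<phi>, s) \<in> pformulas L 1 A" for \<phi> s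
  proof (rule ccontr)
    assume *: "\<not> ?thesis"
    then obtain F where F: "F \<subseteq> p" "finite F"
      "\<not> (\<exists>a\<in>univ N. sat1 N (\<phi>, s) a \<and> (\<forall>\<theta>'\<in>F. sat1 N \<theta>' a))"
      using ex[OF \<phi>] by blast
    obtain G where G: "G \<subseteq> p" "finite G"
      "\<not> (\<exists>a\<in>univ N. sat1 N (Neg \<phi>, s) a \<and> (\<forall>\<theta>'\<in>G. sat1 N \<theta>' a))"
      using ex[OF pformulas_Neg[OF \<phi>]] * by blast
    have "F \<union> G \<subseteq> p" "finite (F \<union> G)" using F G by auto
    then obtain a where "a \<in> univ N" "\<forall>\<theta>\<in>F \<union> G. sat1 N \<theta> a"
      using p(3) unfolding fs_def by meson
    then show False using F(3) G(3) unfolding sat1_Neg by blast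
  qed
  then have "p \<in> types1 L N A" using p unfolding types1_def fs_def by blast
  then show ?thesis using p(1) by blast
qed

text \<open>Compactness for families of definable predicates; the size bound concerns the
  parameters, not the index set.\<close>

lemma (in param_struct) saturated_realize:
  assumes "saturated L \<kappa> S" "|A| <o \<kappa>"
    and D: "\<And>i. i \<in> I \<Longrightarrow> D (\<lambda>w. X i (w 0))"
    and fin: "\<And>J. J \<subseteq> I \<Longrightarrow> finite J \<Longrightarrow> \<exists>a\<in>univ S. \<forall>i\<in>J. X i a"
  shows "\<exists>a\<in>univ S. \<forall>i\<in>I. X i a"
proof -
  have "\<forall>i\<in>I. \<exists>\<theta>. \<theta> \<in> pformulas L 1 A \<and> (\<forall>a\<in>univ S. sat1 S \<theta> a \<longleftrightarrow> X i a)"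
    using D_sat1_ex[OF D] by blast
  then obtain \<Theta> where \<Theta>: "\<And>i. i \<in> I \<Longrightarrow> \<Theta> i \<in> pformulas L 1 A"
    "\<And>i a. i \<in> I \<Longrightarrow> a \<in> univ S \<Longrightarrow> sat1 S (\<Theta> i) a \<longleftrightarrow> X i a"
    using bchoice[of I] by metis
  have "\<exists>p \<in> types1 L S A. \<Theta> ` I \<subseteq> p"
  proof (rule ex_type_extending)
    show "\<Theta> ` I \<subseteq> pformulas L 1 A" using \<Theta>(1) by blast
    fix F assume "F \<subseteq> \<Theta> ` I" "finite F"
    then obtain J where J: "J \<subseteq> I" "finite J" "F = \<Theta> ` J" using finite_subset_image by metis
    then obtain a where "a \<in> univ S" "\<forall>i\<in>J. X i a" using fin by blast
    then have "\<forall>\<theta>\<in>F. sat1 S \<theta> a" using J \<Theta>(2) by auto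
    then show "\<exists>a\<in>univ S. \<forall>\<theta>\<in>F. sat1 S \<theta> a" using \<open>a \<in> univ S\<close> by blast
  qed
  then obtain p where p: "p \<in> types1 L S A" "\<Theta> ` I \<subseteq> p" by blast
  then have "realizations S p \<noteq> {}"
    using assms(1,2) params(1) unfolding saturated_def by blast
  then obtain a where "a \<in> univ S" "\<forall>\<theta>\<in>p. sat1 S \<theta> a" by (auto simp: realizations_def)
  then show ?thesis using p(2) \<Theta>(2) by blast
qed

text \<open>
  Compactness: the three elements of a failure of transitivity are realized one after the other,
  since saturation is available for 1-types only.
\<close>

lemma incomparable_trans_cofinite:
  fixes L :: "('f, 'r) language" and M N :: "('f, 'r, 'a) struct" and \<kappa> :: "'k rel"
  assumes min: "minimal L M" and monster: "monster_model L \<kappa> M N"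
    and \<theta>: "\<theta> \<in> pformulas L 2 (univ M)"
    and P: "P = realizations N (generic_type L M)"
    and equiv: "equiv P {(x, y). x \<in> P \<and> y \<in> P \<and> incomparable (sat2 N \<theta>) x y}"
  shows "\<exists>E \<subseteq> univ M. finite E \<and> (\<forall>x \<in> univ M - E. \<forall>y \<in> univ M - E. \<forall>z \<in> univ M - E.
    incomparable (sat2 M \<theta>) x y \<longrightarrow> incomparable (sat2 M \<theta>) y z \<longrightarrow> incomparable (sat2 M \<theta>) x z)"
    (is "\<exists>E \<subseteq> _. finite E \<and> ?trans E")
proof (rule ccontr)
  assume no: "\<not> ?thesis"
  have ext: "elementary_extension L M N" and sat: "saturated L \<kappa> N" and small: "|univ M| <o \<kappa>"
    using monster by (auto simp: monster_model_def)
  have MN: "univ M \<subseteq> univ N" using ext by (simp add: elementary_extension_def)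
  have infM: "infinite (univ M)" using min by (simp add: minimal_def)
  define bad where "bad S x y z \<longleftrightarrow> incomparable (sat2 S \<theta>) x y \<and> incomparable (sat2 S \<theta>) y z \<and>
    \<not> incomparable (sat2 S \<theta>) x z" for S :: "('f, 'r, 'a) struct" and x y z
  \<comment> \<open>Avoiding each member of \<open>\<F>\<close> means lying outside
    \<open>M\<close>, where all elements are generic.\<close>
  define \<F> where "\<F> = {F. F \<subseteq> univ M \<and> finite F}"
  have sat2_eq: "sat2 M \<theta> x y \<longleftrightarrow> sat2 N \<theta> x y" if "x \<in> univ M" "y \<in> univ M" for x y
  proof -
    obtain \<phi> s where [simp]: "\<theta> = (\<phi>, s)" by (cases \<theta>)
    have "\<forall>i\<in>fv \<phi>. (s(0 := x, 1 := y)) i \<in> univ M"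
      using \<theta> that by (auto simp: pformulas_def Suc_le_eq)
    then show ?thesis
      using ext \<theta> unfolding elementary_extension_def by (auto simp: pformulas_def)
  qed
  have bad_M: "\<exists>x\<in>univ M - F. \<exists>y\<in>univ M - F. \<exists>z\<in>univ M - F. bad N x y z" if "F \<in> \<F>" for F
  proof -
    define tr where "tr E \<longleftrightarrow> ?trans E" for E
    have "\<not> (\<exists>E \<subseteq> univ M. finite E \<and> tr E)" using no unfolding tr_def .
    then have "\<not> tr F" using that by (simp add: \<F>_def)
    then have "\<exists>x\<in>univ M - F. \<exists>y\<in>univ M - F. \<exists>z\<in>univ M - F. bad M x y z"
      unfolding tr_def bad_def by simp
    then obtain x y z where xyz: "x \<in> univ M - F" "y \<in> univ M - F" "z \<in> univ M - F" "bad M x y z"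
      by blast
    then have "bad N x y z" by (simp add: bad_def incomparable_def sat2_eq)
    then show ?thesis using xyz by blast
  qed
  \<comment> \<open>Finitely many avoidance conditions amount to a single one, which yields finite
    satisfiability in all three rounds.\<close>
  have Un: "\<Union>J \<in> \<F>" if "J \<subseteq> \<F>" "finite J" for J
    using that unfolding \<F>_def by (auto intro!: finite_Union)
  have Card: "Card_order \<kappa>" using monster by (simp add: monster_model_def)
  \<comment> \<open>\<open>\<kappa>\<close> is infinite because it exceeds the infinite
    \<open>M\<close>; hence realized elements may be added as parameters.\<close>
  have small1: "|insert x B| <o \<kappa>" if "|B| <o \<kappa>" for x :: 'a and B
  proof -
    have "|univ M| \<le>o |Field \<kappa>|"
      using ordLess_ordIso_trans[OF small ordIso_symmetric[OF card_of_Field_ordIso[OF Card]]]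
      by (rule ordLess_imp_ordLeq)
    then have "infinite (Field \<kappa>)" using infM card_of_ordLeq_finite by metis
    moreover have "|{x}| <o \<kappa>"
      using infM by (intro ordLeq_ordLess_trans[OF card_of_singl_ordLeq small]) auto
    ultimately have "|{x} \<union> B| <o \<kappa>" using Card that by (intro card_of_Un_ordLess_infinite_Field)
    then show ?thesis by simp
  qed
  have D_bad: "dfn L N A (\<lambda>w. bad N (t w) (u w) (v w))"
    if A: "univ M \<subseteq> A" "A \<subseteq> univ N"
      and tuv: "param_struct.T L N A t" "param_struct.T L N A u" "param_struct.T L N A v"
    for A t u v
  proof -
    interpret param_struct L N A by unfold_locales (use A infM in auto)
    have D_lt: "D (\<lambda>w. sat2 N \<theta> (t w) (u w))" if "T t" "T u" for t u
      using D_rel[OF D_sat2 that] \<theta> pformulas_mono[OF A(1)] by blast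
    show ?thesis
      unfolding bad_def incomparable_def by (intro D_conj D_not D_disj D_lt tuv)
  qed
  have D_notin: "dfn L N A (\<lambda>w. t w \<notin> F)"
    if A: "univ M \<subseteq> A" "A \<subseteq> univ N" and t: "param_struct.T L N A t" and F: "F \<in> \<F>" for A t F
  proof -
    interpret param_struct L N A by unfold_locales (use A infM in auto)
    show ?thesis by (intro D_not D_mem_finite t) (use F A in \<open>auto simp: \<F>_def\<close>)
  qed
  \<comment> \<open>At first \<open>y\<close> and \<open>z\<close> may depend on \<open>F\<close>;
    the next two rounds make them uniform in turn.\<close>
  have "\<exists>x\<in>univ N. \<forall>F\<in>\<F>. \<exists>y\<in>univ N. \<exists>z\<in>univ N. x \<notin> F \<and> y \<notin> F \<and> z \<notin> F \<and> bad N x y z"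
  proof -
    interpret param_struct L N "univ M" by unfold_locales (use MN infM in auto)
    show ?thesis
    proof (rule saturated_realize[OF sat small])
      show "D (\<lambda>w. \<exists>y\<in>univ N. \<exists>z\<in>univ N. w 0 \<notin> F \<and> y \<notin> F \<and> z \<notin> F \<and> bad N (w 0) y z)"
        if "F \<in> \<F>" for F
        by (intro D_ex D_conj D_bad D_notin T_var order_refl MN that)
      fix J assume "J \<subseteq> \<F>" "finite J"
      from bad_M[OF Un[OF this]] obtain x y z where
        "x \<in> univ M - \<Union>J" "y \<in> univ M - \<Union>J" "z \<in> univ M - \<Union>J" "bad N x y z"
        by blast
      then show "\<exists>x\<in>univ N. \<forall>F\<in>J. \<exists>y\<in>univ N. \<exists>z\<in>univ N. x \<notin> F \<and> y \<notin> F \<and> z \<notin> F \<and> bad N x y z"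
        using MN by - (rule bexI[of _ x], rule ballI, rule bexI[of _ y], rule bexI[of _ z], auto)
    qed
  qed
  then obtain x where x: "x \<in> univ N"
    "\<And>F. F \<in> \<F> \<Longrightarrow> \<exists>y\<in>univ N. \<exists>z\<in>univ N. x \<notin> F \<and> y \<notin> F \<and> z \<notin> F \<and> bad N x y z"
    by meson
  have Mx: "univ M \<subseteq> insert x (univ M)" "insert x (univ M) \<subseteq> univ N" using x(1) MN by auto
  have "\<exists>y\<in>univ N. \<forall>F\<in>\<F>. \<exists>z\<in>univ N. y \<notin> F \<and> z \<notin> F \<and> bad N x y z"
  proof -
    interpret param_struct L N "insert x (univ M)" by unfold_locales (use Mx in auto)
    show ?thesis
    proof (rule saturated_realize[OF sat small1[OF small]])
      show "D (\<lambda>w. \<exists>z\<in>univ N. w 0 \<notin> F \<and> z \<notin> F \<and> bad N x (w 0) z)" if "F \<in> \<F>" for F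
        by (intro D_ex D_conj D_bad D_notin T_var T_const Mx that) simp
      fix J assume "J \<subseteq> \<F>" "finite J"
      from x(2)[OF Un[OF this]] obtain y z where
        "y \<in> univ N" "z \<in> univ N" "y \<notin> \<Union>J" "z \<notin> \<Union>J" "bad N x y z" by blast
      then show "\<exists>y\<in>univ N. \<forall>F\<in>J. \<exists>z\<in>univ N. y \<notin> F \<and> z \<notin> F \<and> bad N x y z"
        by - (rule bexI[of _ y], rule ballI, rule bexI[of _ z], auto)
    qed
  qed
  then obtain y where y: "y \<in> univ N"
    "\<And>F. F \<in> \<F> \<Longrightarrow> \<exists>z\<in>univ N. y \<notin> F \<and> z \<notin> F \<and> bad N x y z"
    by meson
  have Mxy: "univ M \<subseteq> insert y (insert x (univ M))" "insert y (insert x (univ M)) \<subseteq> univ N"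
    using x(1) y(1) MN by auto
  have "\<exists>z\<in>univ N. \<forall>F\<in>\<F>. z \<notin> F \<and> bad N x y z"
  proof -
    interpret param_struct L N "insert y (insert x (univ M))" by unfold_locales (use Mxy in auto)
    show ?thesis
    proof (rule saturated_realize[OF sat small1[OF small1[OF small]]])
      show "D (\<lambda>w. w 0 \<notin> F \<and> bad N x y (w 0))" if "F \<in> \<F>" for F
        by (intro D_conj D_bad D_notin T_var T_const Mxy that) simp_all
      fix J assume "J \<subseteq> \<F>" "finite J"
      from y(2)[OF Un[OF this]] obtain z where "z \<in> univ N" "z \<notin> \<Union>J" "bad N x y z" by blast
      then show "\<exists>z\<in>univ N. \<forall>F\<in>J. z \<notin> F \<and> bad N x y z" by (intro bexI[of _ z]) auto
    qed
  qed
  then obtain z where z: "z \<in> univ N" "\<And>F. F \<in> \<F> \<Longrightarrow> z \<notin> F \<and> bad N x y z" by blast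
  have \<F>1: "{a} \<in> \<F>" if "a \<in> univ M" for a using that by (simp add: \<F>_def)
  have "x \<notin> univ M" using x(2)[OF \<F>1[of x]] by auto
  moreover have "y \<notin> univ M" using y(2)[OF \<F>1[of y]] by auto
  moreover have "z \<notin> univ M" using z(2)[OF \<F>1[of z]] by auto
  ultimately have "x \<in> P" "y \<in> P" "z \<in> P"
    using generic_realizations[OF min ext] x(1) y(1) z(1) unfolding P by auto
  moreover have "bad N x y z" using z(2)[of "{}"] by (simp add: \<F>_def)
  moreover have "trans {(x, y). x \<in> P \<and> y \<in> P \<and> incomparable (sat2 N \<theta>) x y}"
    using equiv by (simp add: equiv_def)
  ultimately show False unfolding bad_def trans_def by blast
qed

section \<open>From the almost linear order to a definable preorder\<close>

lemma minimal_field_structI: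
  fixes L :: "('f, 'r) language" and M :: "('f, 'r, 'a) struct" and R :: "'a ring"
    and plus times :: 'f
  assumes "minimal L M" "field R" "carrier R = univ M"
    and "(plus, 2) \<in> Funs L" "(times, 2) \<in> Funs L"
    and ops: "\<And>x y. x \<in> univ M \<Longrightarrow> y \<in> univ M \<Longrightarrow>
      fun_int M plus [x, y] = x \<oplus>\<^bsub>R\<^esub> y \<and> fun_int M times [x, y] = x \<otimes>\<^bsub>R\<^esub> y"
  shows "minimal_field_struct L M R"
proof -
  interpret field R by fact
  interpret param_struct L M "univ M"
    by unfold_locales (use assms(1) in \<open>auto simp: minimal_def\<close>)
  show ?thesis
  proof unfold_locales
    show "D (\<lambda>w. w 0 = w 2 \<oplus>\<^bsub>R\<^esub> w 1)"
      by (rule D_cong[OF D_fun2[OF assms(4), of 0 2 1]]) (auto simp: ops image_subset_iff)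
    show "D (\<lambda>w. w 0 = w 2 \<otimes>\<^bsub>R\<^esub> w 1)"
      by (rule D_cong[OF D_fun2[OF assms(5), of 0 2 1]]) (auto simp: ops image_subset_iff)
    show "infinite (univ M)" using assms(1) by (simp add: minimal_def)
    show "carrier R = univ M" by fact
    fix X assume "D (\<lambda>w. X (w 0))"
    then obtain \<theta> where \<theta>: "\<theta> \<in> pformulas L 1 (univ M)" "\<forall>a\<in>univ M. sat1 M \<theta> a \<longleftrightarrow> X a"
      using D_sat1_ex by blast
    then have "{a \<in> univ M. X a} = {a \<in> univ M. sat1 M \<theta> a}"
      "{a \<in> univ M. \<not> X a} = {a \<in> univ M. \<not> sat1 M \<theta> a}" by auto
    then show "finite {a \<in> univ M. X a} \<or> finite {a \<in> univ M. \<not> X a}"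
      using minimalD[OF assms(1) \<theta>(1)] by simp
  qed
qed

text \<open>Not being greater is a total preorder outside \<open>E\<close>, and \<open>E\<close>
  becomes one lowest class. An infinite class would be cofinite and contain two elements of the
  infinite chain, which are comparable.\<close>

lemma (in minimal_field_struct) no_weak_order:
  assumes D_lt: "D (\<lambda>w. lt (w 1) (w 0))"
    and spo: "strict_partial_order_on (univ S) lt"
    and chain: "has_infinite_chain (univ S) lt"
    and E: "finite E" "E \<subseteq> univ S"
    and inc: "\<And>x y z. x \<in> univ S - E \<Longrightarrow> y \<in> univ S - E \<Longrightarrow> z \<in> univ S - E \<Longrightarrow>
      incomparable lt x y \<Longrightarrow> incomparable lt y z \<Longrightarrow> incomparable lt x z"
  shows False
proof -
  have irrefl: "\<not> lt x x" if "x \<in> univ S" for x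
    using spo that by (auto simp: strict_partial_order_on_def irreflp_on_def)
  have lt_trans: "lt x z" if "lt x y" "lt y z" "x \<in> univ S" "y \<in> univ S" "z \<in> univ S" for x y z
    using spo that by (auto simp: strict_partial_order_on_def dest: transp_onD)
  have lt_rule: "D (\<lambda>w. lt (t w) (u w))" if "T t" "T u" for t u
    by (rule D_rel[OF D_lt that])
  define le where "le x y \<longleftrightarrow> x \<in> E \<or> y \<notin> E \<and> \<not> lt y x" for x y
  have D_le: "D (\<lambda>w. le (t w) (u w))" if "T t" "T u" for t u
    unfolding le_def by (intro D_disj D_conj D_not D_mem_finite lt_rule E that)
  obtain C where C: "C \<subseteq> univ S" "infinite C" "totalp_on C lt"
    using chain by (auto simp: has_infinite_chain_def)
  have "def_preorder L S R le"
  proof unfold_locales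
    show "D (\<lambda>w. le (w 1) (w 0))" by (intro D_le T_var)
    show "le x y \<or> le y x" if "x \<in> univ S" "y \<in> univ S" for x y
      using that irrefl[of x] lt_trans[of x y x] by (auto simp: le_def)
    show "le x z" if le: "le x y" "le y z" and U: "x \<in> univ S" "y \<in> univ S" "z \<in> univ S" for x y z
    proof (cases "x \<in> E")
      case False
      then have E': "y \<notin> E" "z \<notin> E" "\<not> lt y x" "\<not> lt z y" using le by (auto simp: le_def)
      have "\<not> lt z x"
      proof
        assume zx: "lt z x"
        \<comment> \<open>Given \<open>lt z x\<close>, either comparison of \<open>x\<close> with
          \<open>y\<close> or \<open>y\<close> with \<open>z\<close> would yield an excluded one, so
          \<open>y\<close> is incomparable to both.\<close>
        have "\<not> lt x y" using lt_trans[OF zx, of y] E' U by auto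
        moreover have "\<not> lt y z" using lt_trans[OF _ zx, of y] E' U by auto
        ultimately have "incomparable lt x z"
          using E' U False by (intro inc[of x y z]) (auto simp: incomparable_def)
        then show False using zx by (simp add: incomparable_def)
      qed
      then show ?thesis using E' by (simp add: le_def)
    qed (simp add: le_def)
    fix a assume a: "a \<in> univ S"
    let ?K = "{x \<in> univ S. le x a \<and> le a x}"
    show "finite ?K"
    proof (rule ccontr)
      assume "infinite ?K"
      then have "finite {x \<in> univ S. \<not> (le x a \<and> le a x)}"
        by (rule cofinite_of_infinite) (intro D_conj D_le T_var T_const a)
      then have "infinite (C - ({x \<in> univ S. \<not> (le x a \<and> le a x)} \<union> E))"
        using C(2) E(1) by (intro Diff_infinite_finite) auto
      then obtain C' where C': "C' \<subseteq> C - ({x \<in> univ S. \<not> (le x a \<and> le a x)} \<union> E)" "card C' = 2"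
        using infinite_arbitrarily_large by metis
      then obtain x y where xy: "x \<in> C'" "y \<in> C'" "x \<noteq> y"
        by (auto simp: card_2_iff)
      then have mem: "x \<in> C" "y \<in> C" "x \<notin> E" "y \<notin> E" "x \<in> ?K" "y \<in> ?K"
        using C' C(1) by auto
      then have "a \<notin> E" by (auto simp: le_def)
      have U: "x \<in> univ S" "y \<in> univ S" using mem C(1) by auto
      have "incomparable lt x a" "incomparable lt a y"
        using mem \<open>a \<notin> E\<close> by (auto simp: le_def incomparable_def)
      then have "incomparable lt x y"
        using inc[of x a y] mem U a \<open>a \<notin> E\<close> by auto
      then show False
        using C(3) mem xy(3) by (auto simp: incomparable_def totalp_on_def)
    qed
  qed
  then show False by (rule def_preorder.no_def_preorder)
qed

theorem theorem3:
  fixes L :: "('f, 'r) language" and M N :: "('f, 'r, 'a) struct" and \<kappa> :: "'k rel"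
  assumes "minimal_field L M" and "monster_model L \<kappa> M N"
  shows "\<not> almost_linear L M N"
proof
  assume "almost_linear L M N"
  then obtain \<theta> where \<theta>: "almost_linear_order L M N \<theta>" by (auto simp: almost_linear_def)
  let ?P = "realizations N (generic_type L M)"
  have pf: "\<theta> \<in> pformulas L 2 (univ M)"
    and spo: "strict_partial_order_on (univ M) (sat2 M \<theta>)"
    and chain: "has_infinite_chain (univ M) (sat2 M \<theta>)"
    and equiv: "equiv ?P {(x, y). x \<in> ?P \<and> y \<in> ?P \<and> incomparable (sat2 N \<theta>) x y}"
    using \<theta> by (simp_all add: almost_linear_order_def Let_def)
  have min: "minimal L M" using assms(1) by (simp add: minimal_field_def)
  obtain R :: "'a ring" and plus times where R: "field R" "carrier R = univ M"
    "(plus, 2) \<in> Funs L" "(times, 2) \<in> Funs L"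
    "\<forall>x\<in>univ M. \<forall>y\<in>univ M.
      fun_int M plus [x, y] = x \<oplus>\<^bsub>R\<^esub> y \<and> fun_int M times [x, y] = x \<otimes>\<^bsub>R\<^esub> y"
    using assms(1) unfolding minimal_field_def by (elim exE conjE)
  interpret minimal_field_struct L M R 
    by (rule minimal_field_structI[OF min R(1-4)]) (use R(5) in simp)
  obtain E where E: "E \<subseteq> univ M" "finite E"
    "\<forall>x \<in> univ M - E. \<forall>y \<in> univ M - E. \<forall>z \<in> univ M - E.
    incomparable (sat2 M \<theta>) x y \<longrightarrow> incomparable (sat2 M \<theta>) y z \<longrightarrow> incomparable (sat2 M \<theta>) x z"
    using incomparable_trans_cofinite[OF min assms(2) pf refl equiv] by (elim exE conjE)
  show False
    by (rule no_weak_order[OF D_sat2[OF pf] spo chain E(2,1)]) (use E(3) in blast)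
qed

end
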